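(* Let $a>0$, $T\in\mathbb{C}$, and let $F\in H_{a,T}$. Then there are complex coefficients $A_k$, $k=0,1,2,\ldots$, such that, for the branch of $F$ analytic in the $t$-plane cut along $(-\infty,-a]$, in the region $|t+a|<a$, $|\arg(t+a)|<\pi$ the formula $$F(t)=\sum_{k=0}^{\infty}A_k(t+a)^k-\frac{T}{2\pi i}F\left(-(t+a)\right)\log(t+a)$$ is valid, where the series is absolutely convergent. Moreover, for every $r\in(0,\infty)$, $$A_0=\frac{1}{2\pi i}\int_{C(r)}e^{-a\zeta}P(\zeta)\frac{d\zeta}{\zeta}+\frac{T}{2\pi i}\int_r^{+\infty}\frac{P(\zeta)-p_0}{\zeta}\,d\zeta-\frac{Tp_0}{2\pi i}\left(\gamma+\log r\right),$$ where $p_0=F(0)$, $P=\mathcal{L}\{F\}$, and $\gamma$ is Euler's constant.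
   Context: Fix $a>0$ and $T\in\mathbb{C}$. **The space $H_{a,T}$.** It is the linear space of all functions $F(t)$ such that: (i) $F$ is a (possibly multi-valued) analytic function in the complex $t$-plane punctured at the two finite points $t=0$ and $t=-a$ (it can be continued analytically along any path avoiding these points), and $F$ has exponential growth of minimal type at $\infty$ in any sectorial region $\{t:-\infty<\alpha<\arg t<\beta<+\infty\}$; that is, for every $\varepsilon>0$ there is a constant $K$ such that $|F(t)|\le Ke^{\varepsilon|t|}$ for all $t$ in the region with $|t|$ sufficiently large. (ii) There is a branch of $F$ which is analytic in the $t$-plane cut along $(-\infty,-a]$ (in particular it is analytic at $t=0$). This branch is again denoted $F$. (iii) The branch in (ii) satisfies $F(t)=O(\log(t+a))$ as $t\to-a$, $|t+a|<a$, $|\arg(t+a)|<\pi$. (iv) The branch in (ii) satisfies, for $-a<t<+\infty$, $$F\left((t+a)e^{\pi i}-a\right)=F\left((t+a)e^{-\pi i}-a\right)-TF\left(-(t+a)e^{\pi i}\right);$$ equivalently, for $s>0$, $F(se^{\pi i}-a)=F(se^{-\pi i}-a)-TF(s)$, where $se^{\pi i}-a$ and $se^{-\pi i}-a$ denote the points $-a-s$ on the upper and lower banks of the cut $(-\infty,-a]$, respectively. **Notation.** For $|t+a|<a$, $F(-(t+a))$ is the value of the branch in (ii) at the point $-(t+a)$ of the disc of radius $a$ centred at $0$; $\log$ is the principal branch. $P=\mathcal{L}\{F\}$ is the function $P(\zeta)=\zeta\int_0^{+\infty}e^{-\zeta t}F(t)\,dt$ for $|\arg\zeta|<\pi/2$,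 continued analytically to $|\arg\zeta|\le\pi$, $\zeta\ne0$ (on the Riemann surface of the logarithm). $C(r)=\{\zeta:|\zeta|=r,\ -\pi<\arg\zeta<\pi\}$ is oriented anti-clockwise. *)

theory Defs
  imports "HOL-Complex_Analysis.Complex_Analysis" "HOL-Library.Landau_Symbols"
begin

text \<open>
  A multi-valued function in the plane punctured at \<open>0\<close> and \<open>-a\<close> is represented by its branch
  \<open>F\<close> in the cut plane; the values of \<open>F\<close> on the cut itself are irrelevant. All other branches are
  obtained from \<open>F\<close> by analytic continuation along paths.
\<close>

definition cut_plane :: "real \<Rightarrow> complex set" where
  "cut_plane a = - (complex_of_real ` {..-a})"

definition cut_disc :: "real \<Rightarrow> complex set" where
  "cut_disc a = {t. norm (t + of_real a) < a \<and> t \<noteq> - of_real a \<and> \<bar>Arg (t + of_real a)\<bar> < pi}"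

text \<open>
  The function \<open>\<Phi> u\<close> represents a germ at \<open>\<gamma> u\<close>; only its values near \<open>\<gamma> u\<close> matter.
\<close>

definition analytic_continuation_along ::
    "(complex \<Rightarrow> complex) \<Rightarrow> (real \<Rightarrow> complex) \<Rightarrow> (real \<Rightarrow> complex \<Rightarrow> complex) \<Rightarrow> bool" where
  "analytic_continuation_along F \<gamma> \<Phi> \<longleftrightarrow>
     (\<forall>\<^sub>F z in nhds (\<gamma> 0). \<Phi> 0 z = F z) \<and>
     (\<forall>u\<in>{0..1}. \<Phi> u analytic_on {\<gamma> u} \<and>
        (\<forall>\<^sub>F v in at u within {0..1}. \<forall>\<^sub>F z in nhds (\<gamma> v). \<Phi> v z = \<Phi> u z))"

definition admissible_path :: "real \<Rightarrow> (real \<Rightarrow> complex) \<Rightarrow> bool" where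
  "admissible_path a \<gamma> \<longleftrightarrow>
     path \<gamma> \<and> path_image \<gamma> \<subseteq> - {0, - of_real a} \<and> pathstart \<gamma> \<in> cut_plane a"

text \<open>
  Points of the Riemann surface of the logarithm are represented by their logarithms \<open>w\<close>, the
  projection to the plane being \<open>exp\<close>. Thus \<open>Im w\<close> is the argument, ranging over all reals, and
  the set below is the part \<open>\<bar>t\<bar> > R\<close> of the sectorial region \<open>\<alpha> < arg t < \<beta>\<close>. For \<open>R \<ge> a\<close> its
  projection avoids the two singular points.
\<close>

definition log_sector :: "real \<Rightarrow> real \<Rightarrow> real \<Rightarrow> complex set" where
  "log_sector R \<alpha> \<beta> = {w. norm (exp w) > R \<and> \<alpha> < Im w \<and> Im w < \<beta>}"

definition branch_on_log_sector ::
    "real \<Rightarrow> (complex \<Rightarrow> complex) \<Rightarrow> real \<Rightarrow> real \<Rightarrow> real \<Rightarrow> (complex \<Rightarrow> complex) \<Rightarrow> bool" where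
  "branch_on_log_sector a F R \<alpha> \<beta> G \<longleftrightarrow>
     G holomorphic_on log_sector R \<alpha> \<beta> \<and>
     (\<exists>\<gamma> \<Phi>. \<exists>w\<in>log_sector R \<alpha> \<beta>.
        admissible_path a \<gamma> \<and> analytic_continuation_along F \<gamma> \<Phi> \<and> pathfinish \<gamma> = exp w \<and>
        (\<forall>\<^sub>F v in nhds w. G v = \<Phi> 1 (exp v)))"

definition minimal_type_at_infinity :: "real \<Rightarrow> (complex \<Rightarrow> complex) \<Rightarrow> bool" where
  "minimal_type_at_infinity a F \<longleftrightarrow>
     (\<forall>R \<alpha> \<beta> G. a \<le> R \<and> branch_on_log_sector a F R \<alpha> \<beta> G \<longrightarrow>
        (\<forall>\<epsilon>>0. \<exists>K. \<exists>R'\<ge>R. \<forall>w\<in>log_sector R' \<alpha> \<beta>. norm (G w) \<le> K * exp (\<epsilon> * norm (exp w))))"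

text \<open>
  In the last condition, \<open>u\<close> and \<open>l\<close> are the values of the branch at the point \<open>-a-s\<close> on the upper
  and the lower bank of the cut.
\<close>

definition H_space :: "real \<Rightarrow> complex \<Rightarrow> (complex \<Rightarrow> complex) set" where
  "H_space a T = {F.
     (\<forall>\<gamma>. admissible_path a \<gamma> \<longrightarrow> (\<exists>\<Phi>. analytic_continuation_along F \<gamma> \<Phi>)) \<and>
     minimal_type_at_infinity a F \<and>
     F holomorphic_on cut_plane a \<and>
     F \<in> O[at (- of_real a) within cut_disc a](\<lambda>t. Ln (t + of_real a)) \<and>
     (\<forall>s>0. \<exists>u l.
        (F \<longlongrightarrow> u) (at (- of_real (a + s)) within {t. Im t > 0}) \<and>
        (F \<longlongrightarrow> l) (at (- of_real (a + s)) within {t. Im t < 0}) \<and>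
        u = l - T * F (of_real s))}"

text \<open>
  The Laplace transform \<open>P\<close>, continued analytically to \<open>\<bar>arg \<zeta>\<bar> \<le> \<pi>\<close> on the Riemann surface of
  the logarithm, again in the coordinate \<open>w\<close> with \<open>\<zeta> = exp w\<close>. By the identity theorem the
  conditions determine the function on the closed strip.
\<close>

definition laplace_log :: "(complex \<Rightarrow> complex) \<Rightarrow> complex \<Rightarrow> complex" where
  "laplace_log F = (SOME Q. Q analytic_on {w. \<bar>Im w\<bar> \<le> pi} \<and>
     (\<forall>w. \<bar>Im w\<bar> < pi / 2 \<longrightarrow>
        Q w = exp w * (LBINT t:{0..}. exp (- exp w * of_real t) * F (of_real t))))"

text \<open>The restriction of \<open>P\<close> to the principal sheet \<open>-\<pi> < arg \<zeta> \<le> \<pi>\<close>.\<close>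

definition laplace_L :: "(complex \<Rightarrow> complex) \<Rightarrow> complex \<Rightarrow> complex" where
  "laplace_L F \<zeta> = laplace_log F (Ln \<zeta>)"

end

theory Submission
  imports Defs
begin

text \<open>
Write \<open>z = t + a\<close>. Both halves of the theorem rest on the jump condition across the cut.

\<^bold>\<open>The expansion.\<close> The logarithm jumps by \<open>2 * pi * \<i>\<close> across the negative \<open>z\<close>-axis and \<open>F (- z)\<close> does not
jump there, so the function
\<open>g z = F (z - a) + T / (2 * pi * \<i>) * F (- z) * Ln z\<close> has equal limits on the two banks. Multiplied by
\<open>z\<close> it also tends to \<open>0\<close> at the tip, because \<open>F\<close> is only logarithmically large there. Hence \<open>z * g z\<close>
extends continuously to the whole disc of radius \<open>a\<close> and is holomorphic off the real line, so it is
holomorphic, and \<open>g\<close> itself is given by a holomorphic function \<open>h\<close> on the disc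
(\<open>H_space_expansion_function\<close>). The coefficients \<open>A k\<close> are the Taylor coefficients of \<open>h\<close>; in
particular \<open>A 0\<close> is the limit of \<open>g z\<close> as \<open>z\<close> decreases to \<open>0\<close>.

\<^bold>\<open>The constant term.\<close> In the coordinate \<open>\<zeta> = exp w\<close> the Laplace transform is
\<open>P = \<integral> exp (- s) * F (s * exp (- w)) ds\<close>, an integral of \<open>F\<close> along the ray of argument \<open>- Im w\<close>. In
this form it is holomorphic for \<open>\<bar>Im w\<bar> < pi\<close>, and \<open>Im w \<longlongrightarrow> \<plusminus>pi\<close> makes the ray approach a bank of the
cut. Fix \<open>t = z - a\<close> with \<open>z > 0\<close> and let \<open>D s = (F s - F t) / (s - t)\<close>, with Laplace integral
\<open>M \<zeta> = \<integral> exp (- \<zeta> * s) * D s ds\<close>. Differentiation under the integral sign gives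
\<open>d/d\<zeta> (exp (t * \<zeta>) * M \<zeta>) = - exp (t * \<zeta>) * (P \<zeta> - F t) / \<zeta>\<close>
(\<open>divided_difference_laplace_has_field_derivative\<close>), so the integral of the right-hand side over the
circle is the difference of the values of the primitive at the arguments \<open>\<plusminus>pi\<close>. There \<open>M\<close> is an
integral over a bank (\<open>ray_laplace_bank_limit\<close>), and by the jump condition the difference of the two
bank integrals involves only \<open>F\<close> on the positive axis. The result (\<open>H_space_inversion\<close>) is the
inversion formula
\<open>2 * pi * \<i> * F (z - a) = \<integral>\<^sub>C exp ((z - a) * \<zeta>) * P \<zeta> / \<zeta> d\<zeta> + T * exp (- r * z) * \<integral> exp (- r * s) * F s / (z + s) ds\<close>.

It remains to let \<open>z\<close> decrease to \<open>0\<close>. Splitting \<open>F s = F 0 + (F s - F 0)\<close> in the last integral, the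
second part converges to \<open>\<integral> exp (- r * s) * (F s - F 0) / s ds\<close>, which by Fubini is the tail integral of
\<open>(P x - F 0) / x\<close> over \<open>x \<ge> r\<close> (\<open>laplace_tail_integral\<close>). The first part is \<open>F 0\<close> times an exponential
integral that behaves like \<open>- ln z - \<gamma> - ln r\<close> (\<open>exp_stieltjes_tendsto\<close>), and its \<open>ln z\<close> cancels the
logarithm in \<open>g\<close>.
\<close>

section \<open>Integrals depending on a parameter\<close>

text \<open>
Dominated convergence along a filter instead of a sequence. Convergence and domination are required
everywhere on \<open>A\<close>, so that the limit is measurable as a pointwise limit of a sequence; an exceptional
point is to be removed from \<open>A\<close> beforehand.
\<close>

lemma set_dominated_convergence_within:
  fixes f :: "'b::first_countable_topology \<Rightarrow> real \<Rightarrow> 'c::{banach,second_countable_topology}"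
  assumes A: "A \<in> sets borel" and nt: "at x within S \<noteq> bot"
    and ev: "\<forall>\<^sub>F w in at x within S. set_borel_measurable lborel A (f w) \<and> (\<forall>s\<in>A. norm (f w s) \<le> G s)"
    and G: "set_integrable lborel A G"
    and lim: "\<And>s. s \<in> A \<Longrightarrow> ((\<lambda>w. f w s) \<longlongrightarrow> g s) (at x within S)"
  shows "set_integrable lborel A g"
    and "((\<lambda>w. LBINT s:A. f w s) \<longlongrightarrow> (LBINT s:A. g s)) (at x within S)"
proof -
  let ?f = "\<lambda>w s. indicator A s *\<^sub>R f w s"
  have key: "integrable lborel (\<lambda>s. indicator A s *\<^sub>R g s) \<and>
      (\<lambda>n. LBINT s. ?f (X n) s) \<longlonglongrightarrow> (LBINT s. indicator A s *\<^sub>R g s)"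
    if X: "\<forall>i. X i \<in> S - {x}" "X \<longlonglongrightarrow> x" for X
  proof -
    have "filterlim X (at x within S) sequentially"
      using X by (auto simp: filterlim_at)
    then have "\<forall>\<^sub>F n in sequentially.
        set_borel_measurable lborel A (f (X n)) \<and> (\<forall>s\<in>A. norm (f (X n) s) \<le> G s)"
      by (rule eventually_compose_filterlim[OF ev])
    then obtain N where N: "\<And>n. n \<ge> N \<Longrightarrow>
        set_borel_measurable lborel A (f (X n)) \<and> (\<forall>s\<in>A. norm (f (X n) s) \<le> G s)"
      by (auto simp: eventually_sequentially)
    have lims: "(\<lambda>n. ?f (X (n + N)) s) \<longlonglongrightarrow> indicator A s *\<^sub>R g s" for s
    proof (cases "s \<in> A")
      case True
      have "((\<lambda>w. f w s) \<circ> X) \<longlonglongrightarrow> g s"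
        using lim[OF True] X by (simp add: tendsto_at_iff_sequentially)
      then show ?thesis
        using True LIMSEQ_ignore_initial_segment[of "\<lambda>n. f (X n) s"] by (simp add: o_def)
    qed simp
    have meas: "?f (X (n + N)) \<in> borel_measurable lborel" for n
      using N[of "n + N"] by (simp add: set_borel_measurable_def)
    have gm: "(\<lambda>s. indicator A s *\<^sub>R g s) \<in> borel_measurable lborel"
      by (rule borel_measurable_LIMSEQ_metric[OF meas lims])
    have bd: "norm (?f (X (n + N)) s) \<le> indicator A s *\<^sub>R G s" for n s
      using N[of "n + N"] by (auto simp: indicator_def)
    have Gi: "integrable lborel (\<lambda>s. indicator A s *\<^sub>R G s)"
      using G by (simp add: set_integrable_def)
    have "(\<lambda>n. LBINT s. ?f (X (n + N)) s) \<longlonglongrightarrow> (LBINT s. indicator A s *\<^sub>R g s)"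
      by (rule integral_dominated_convergence[OF gm meas Gi]) (use lims bd in auto)
    moreover have "integrable lborel (\<lambda>s. indicator A s *\<^sub>R g s)"
      by (rule integrable_dominated_convergence[where s = "\<lambda>n. ?f (X (n + N))", OF gm meas Gi]) (use lims bd in auto)
    ultimately show ?thesis
      using LIMSEQ_offset[of "\<lambda>n. LBINT s. ?f (X n) s" N] by blast
  qed
  show "((\<lambda>w. LBINT s:A. f w s) \<longlongrightarrow> (LBINT s:A. g s)) (at x within S)"
    using key by (auto simp: tendsto_at_iff_sequentially set_lebesgue_integral_def o_def)
  have "x islimpt S" using nt by (simp add: trivial_limit_within)
  then have "\<exists>X. (\<forall>i. X i \<in> S - {x}) \<and> X \<longlonglongrightarrow> x"
    by (simp add: islimpt_sequential)
  then show "set_integrable lborel A g"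
    using key by (auto simp: set_integrable_def)
qed

text \<open>
On a smaller disc Cauchy's inequality turns the bound \<open>G\<close> on the integrand into a bound on its
\<open>w\<close>-derivative, hence on its difference quotients, and dominated convergence applies to these.
\<close>

lemma holomorphic_parametric_integral:
  fixes f :: "complex \<Rightarrow> real \<Rightarrow> complex"
  assumes A: "A \<in> sets borel" and S: "open S"
    and hol: "\<And>s. s \<in> A \<Longrightarrow> (\<lambda>w. f w s) holomorphic_on S"
    and meas: "\<And>w. w \<in> S \<Longrightarrow> set_borel_measurable lborel A (f w)"
    and bd: "\<And>w s. w \<in> S \<Longrightarrow> s \<in> A \<Longrightarrow> norm (f w s) \<le> G s"
    and G: "set_integrable lborel A G"
    and w0: "w0 \<in> S"
  shows "((\<lambda>w. LBINT s:A. f w s) has_field_derivative (LBINT s:A. deriv (\<lambda>w. f w s) w0)) (at w0)"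
proof -
  obtain R where R: "R > 0" "cball w0 (2 * R) \<subseteq> S"
  proof -
    obtain e where "e > 0" "cball w0 e \<subseteq> S" using S w0 open_contains_cball by blast
    then show ?thesis by (intro that[of "e/2"]) auto
  qed
  have int: "set_integrable lborel A (f w)" if "w \<in> S" for w
    by (rule set_integrable_bound[OF G])
      (use that meas bd in \<open>auto simp: set_borel_measurable_def intro!: AE_I2 order_trans[OF bd]\<close>)
  have quot: "norm ((f w s - f w0 s) / (w - w0)) \<le> G s * (1 / R)"
    if w: "w \<in> ball w0 R - {w0}" and s: "s \<in> A" for w s
  proof -
    have h: "(\<lambda>w. f w s) holomorphic_on S" using hol s by simp
    have d: "norm (deriv (\<lambda>w. f w s) v) \<le> G s / R" if v: "v \<in> ball w0 R" for v
    proof -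
      have sub: "cball v R \<subseteq> S"
      proof
        fix y assume "y \<in> cball v R"
        then have "dist w0 y \<le> 2 * R"
          using v dist_triangle[of w0 y v] by (auto simp: dist_commute)
        then show "y \<in> S" using R by auto
      qed
      have "norm ((deriv ^^ 1) (\<lambda>w. f w s) v) \<le> fact 1 * G s / R ^ 1"
      proof (rule Cauchy_inequality)
        show "(\<lambda>w. f w s) holomorphic_on ball v R"
          using h sub ball_subset_cball by (blast intro: holomorphic_on_subset)
        show "continuous_on (cball v R) (\<lambda>w. f w s)"
          using h sub by (blast intro: holomorphic_on_imp_continuous_on holomorphic_on_subset)
        show "norm (f x s) \<le> G s" if "norm (v - x) = R" for x
          using that sub s bd by (auto simp: dist_norm subset_eq)
      qed (use R in auto)
      then show ?thesis by simp
    qed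
    have "norm (f w s - f w0 s) \<le> G s / R * norm (w - w0)"
    proof (rule field_differentiable_bound[of "ball w0 R"])
      show "((\<lambda>w. f w s) has_field_derivative deriv (\<lambda>w. f w s) z) (at z within ball w0 R)"
        if "z \<in> ball w0 R" for z
        using h R that by (intro has_field_derivative_at_within[OF holomorphic_derivI[of _ S]] S) auto
    qed (use d w R in auto)
    then show ?thesis using w by (simp add: norm_divide field_simps)
  qed
  have "((\<lambda>w. LBINT s:A. (f w s - f w0 s) / (w - w0)) \<longlongrightarrow> (LBINT s:A. deriv (\<lambda>w. f w s) w0)) (at w0)"
  proof (rule set_dominated_convergence_within[OF A])
    have "\<forall>\<^sub>F w in at w0. w \<in> ball w0 R - {w0}"
      using R by (intro eventually_at_in_open) auto
    then show "\<forall>\<^sub>F w in at w0. set_borel_measurable lborel A (\<lambda>s. (f w s - f w0 s) / (w - w0)) \<and>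
        (\<forall>s\<in>A. norm ((f w s - f w0 s) / (w - w0)) \<le> G s * (1 / R))"
    proof eventually_elim
      case (elim w)
      then have "set_borel_measurable lborel A (f w)" "set_borel_measurable lborel A (f w0)"
        using R w0 by (auto intro!: meas)
      then have "set_borel_measurable lborel A (\<lambda>s. (f w s - f w0 s) / (w - w0))"
        unfolding set_borel_measurable_def
      proof -
        assume [measurable]: "(\<lambda>x. indicator A x *\<^sub>R f w x) \<in> borel_measurable lborel"
          "(\<lambda>x. indicator A x *\<^sub>R f w0 x) \<in> borel_measurable lborel"
        have "(\<lambda>x. (indicator A x *\<^sub>R f w x - indicator A x *\<^sub>R f w0 x) / (w - w0))
            \<in> borel_measurable lborel" by measurable
        then show "(\<lambda>x. indicator A x *\<^sub>R ((f w x - f w0 x) / (w - w0))) \<in> borel_measurable lborel"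
          by (simp add: scaleR_conv_of_real right_diff_distrib)
      qed
      then show ?case using quot elim by blast
    qed
    show "set_integrable lborel A (\<lambda>s. G s * (1 / R))"
      using G by (rule set_integrable_mult_left)
    show "((\<lambda>w. (f w s - f w0 s) / (w - w0)) \<longlongrightarrow> deriv (\<lambda>w. f w s) w0) (at w0)" if "s \<in> A" for s
      using holomorphic_derivI[OF hol[OF that] S w0] by (simp add: has_field_derivative_iff)
  qed auto
  moreover have "\<forall>\<^sub>F w in at w0. (LBINT s:A. (f w s - f w0 s) / (w - w0)) =
      ((LBINT s:A. f w s) - (LBINT s:A. f w0 s)) / (w - w0)"
  proof -
    have "\<forall>\<^sub>F w in at w0. w \<in> S" using S w0 by (rule eventually_at_in_open')
    then show ?thesis
      by eventually_elim (simp add: int w0 set_integral_diff)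
  qed
  ultimately show ?thesis
    unfolding has_field_derivative_iff by (rule Lim_transform_eventually)
qed

section \<open>Functions on the cut plane of minimal exponential type\<close>

text \<open>
The growth condition that all later estimates use. It combines minimal exponential type at infinity
with a bound at the tip \<open>-a\<close>. There the inverse square root stands in for the logarithm: it is still
integrable, and unlike \<open>\<bar>ln \<bar>t + a\<bar>\<bar>\<close> it decreases in \<open>\<bar>t + a\<bar>\<close>, so a lower bound for the
distance to the tip can be substituted. The bound holds up to the banks of the cut, which is what
makes the passage to the banks possible.
\<close>

definition slit_function :: "real \<Rightarrow> (complex \<Rightarrow> complex) \<Rightarrow> bool" where
  "slit_function a f \<longleftrightarrow> f holomorphic_on cut_plane a \<and>
     (\<forall>\<epsilon>>0. \<exists>C. \<forall>t\<in>cut_plane a.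
        norm (f t) \<le> C * (1 + 1 / sqrt (norm (t + of_real a))) * exp (\<epsilon> * norm t))"

lemma open_cut_plane: "open (cut_plane a)"
proof -
  have "cut_plane a = - (\<real> \<inter> {z. Re z \<le> -a})"
    by (auto simp: cut_plane_def complex_is_Real_iff complex_eq_iff image_iff)
  then show ?thesis
    by (auto simp only: open_closed double_compl intro!: closed_Int closed_complex_Reals closed_halfspace_Re_le)
qed

lemma set_integrable_lborel_nonneg:
  fixes f :: "real \<Rightarrow> real"
  assumes "f integrable_on A" "\<And>x. x \<in> A \<Longrightarrow> f x \<ge> 0" "f \<in> borel_measurable borel" "A \<in> sets borel"
  shows "set_integrable lborel A f"
proof -
  have "f absolutely_integrable_on A"
    using assms by (intro nonnegative_absolutely_integrable_1) auto
  then show ?thesis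
    using assms unfolding set_integrable_def
    by (subst (asm) integrable_completion) (auto intro!: borel_measurable_scaleR borel_measurable_indicator)
qed

lemma set_integrable_exp_minus:
  fixes c :: real
  assumes "c > 0"
  shows "set_integrable lborel {b..} (\<lambda>s. exp (- c * s))"
proof (rule set_integrable_lborel_nonneg)
  show "(\<lambda>s. exp (- c * s)) integrable_on {b..}"
    using integrable_on_exp_minus_to_infinity[OF assms] .
qed auto

text \<open>
A ray at an angle of at most \<open>\<beta>\<close> to the positive axis keeps the distance \<open>b * sin \<beta>\<close> from \<open>-b\<close>.
Applied to every \<open>b \<ge> a\<close>, this shows that the ray avoids the cut; applied to \<open>b = a\<close>, it bounds the
singular factor at the tip from the growth condition.
\<close>

lemma norm_ray_plus_real_ge:
  assumes "b \<ge> 0" "s \<ge> 0" "\<bar>Im v\<bar> \<le> \<beta>" "\<beta> \<le> pi"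
  shows "norm (of_real s * exp v + of_real b) \<ge> b * sin \<beta>"
proof (rule power2_le_imp_le)
  define \<sigma> where "\<sigma> = s * exp (Re v)"
  have \<sigma>: "\<sigma> \<ge> 0" using assms by (simp add: \<sigma>_def)
  have "cos \<beta> \<le> cos \<bar>Im v\<bar>"
    using assms by (intro cos_monotone_0_pi_le) auto
  then have c: "b * \<sigma> * cos \<beta> \<le> b * \<sigma> * cos (Im v)"
    using assms \<sigma> by (intro mult_left_mono) auto
  have "(norm (of_real s * exp v + of_real b))\<^sup>2 = (\<sigma> * cos (Im v) + b)\<^sup>2 + (\<sigma> * sin (Im v))\<^sup>2"
    by (simp add: cmod_power2 \<sigma>_def Re_exp Im_exp mult.assoc)
  also have "\<dots> = \<sigma>\<^sup>2 * ((sin (Im v))\<^sup>2 + (cos (Im v))\<^sup>2) + 2 * (b * \<sigma> * cos (Im v)) + b\<^sup>2"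
    by algebra
  also have "\<dots> \<ge> \<sigma>\<^sup>2 + 2 * (b * \<sigma> * cos \<beta>) + b\<^sup>2"
    using c by simp
  also have "\<sigma>\<^sup>2 + 2 * (b * \<sigma> * cos \<beta>) + b\<^sup>2 = (\<sigma> + b * cos \<beta>)\<^sup>2 + b\<^sup>2 * (1 - (cos \<beta>)\<^sup>2)"
    by (simp add: power2_eq_square algebra_simps)
  also have "\<dots> \<ge> b\<^sup>2 * (1 - (cos \<beta>)\<^sup>2)" by simp
  also have "b\<^sup>2 * (1 - (cos \<beta>)\<^sup>2) = (b * sin \<beta>)\<^sup>2"
    by (simp add: sin_squared_eq power_mult_distrib)
  finally show "(b * sin \<beta>)\<^sup>2 \<le> (norm (of_real s * exp v + of_real b))\<^sup>2" by simp
qed auto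

lemma ray_in_cut_plane:
  assumes "a > 0" "s \<ge> 0" "\<bar>Im v\<bar> < pi"
  shows "of_real s * exp v \<in> cut_plane a"
proof -
  have "of_real s * exp v \<noteq> of_real x" if "x \<le> -a" for x
  proof
    assume eq: "of_real s * exp v = complex_of_real x"
    define \<beta> where "\<beta> = (\<bar>Im v\<bar> + pi) / 2"
    have "-x * sin \<beta> \<le> norm (of_real s * exp v + of_real (-x))"
      using assms that by (intro norm_ray_plus_real_ge) (auto simp: \<beta>_def)
    moreover have "-x * sin \<beta> > 0"
      using assms that by (intro mult_pos_pos sin_gt_zero) (auto simp: \<beta>_def)
    ultimately show False by (simp add: eq)
  qed
  then show ?thesis by (auto simp: cut_plane_def)
qed

lemma slit_function_sector_bound:
  assumes "slit_function a f" "a > 0" "0 < \<beta>" "\<beta> < pi" "\<epsilon> > 0"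
  obtains C where "C \<ge> 0"
    "\<And>s v. s \<ge> 0 \<Longrightarrow> \<bar>Im v\<bar> \<le> \<beta> \<Longrightarrow> norm (f (of_real s * exp v)) \<le> C * exp (\<epsilon> * (s * exp (Re v)))"
proof -
  obtain C where C: "\<And>t. t \<in> cut_plane a \<Longrightarrow>
      norm (f t) \<le> C * (1 + 1 / sqrt (norm (t + of_real a))) * exp (\<epsilon> * norm t)"
    using assms unfolding slit_function_def by blast
  have sin: "a * sin \<beta> > 0" using assms by (simp add: sin_gt_zero)
  have "norm (f (of_real s * exp v)) \<le> \<bar>C\<bar> * (1 + 1 / sqrt (a * sin \<beta>)) * exp (\<epsilon> * (s * exp (Re v)))"
    if "s \<ge> 0" "\<bar>Im v\<bar> \<le> \<beta>" for s v
  proof -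
    have "norm (f (of_real s * exp v)) \<le>
        C * (1 + 1 / sqrt (norm (of_real s * exp v + of_real a))) * exp (\<epsilon> * norm (of_real s * exp v))"
      using assms that by (intro C ray_in_cut_plane) auto
    also have "\<dots> \<le> \<bar>C\<bar> * (1 + 1 / sqrt (a * sin \<beta>)) * exp (\<epsilon> * norm (of_real s * exp v))"
      using assms that sin norm_ray_plus_real_ge[of a s v \<beta>]
      by (intro mult_mono mult_nonneg_nonneg add_mono divide_left_mono real_sqrt_le_mono mult_pos_pos) auto
    finally show ?thesis using that by (simp add: norm_mult)
  qed
  then show thesis
    using sin by (intro that[of "\<bar>C\<bar> * (1 + 1 / sqrt (a * sin \<beta>))"]) auto
qed

section \<open>Laplace integrals along rotated rays\<close>

text \<open>
The integral \<open>\<integral> exp (- u) * f (u * exp (- w)) du\<close> taken over the ray \<open>u = s * exp \<eta>\<close>. For \<open>\<eta> = 0\<close> it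
defines the continuation of the Laplace transform to the strip \<open>\<bar>Im w\<bar> < pi\<close>; for \<open>\<eta> = w\<close> it is
\<open>exp w\<close> times the Laplace integral of \<open>f\<close> at \<open>exp w\<close>. The factor \<open>exp (- u)\<close> decays for
\<open>\<bar>Im \<eta>\<bar> < pi / 2\<close>, and the argument of \<open>f\<close> stays off the cut for \<open>\<bar>Im (\<eta> - w)\<bar> < pi\<close>.
\<close>

definition ray_laplace :: "(complex \<Rightarrow> complex) \<Rightarrow> complex \<Rightarrow> complex \<Rightarrow> complex" where
  "ray_laplace f \<eta> w =
     (LBINT s:{0..}. exp (- (of_real s * exp \<eta>)) * f (of_real s * exp (\<eta> - w)) * exp \<eta>)"

text \<open>
Near \<open>(\<eta>, w)\<close> the exponential decays at a rate bounded below, and the exponential type of \<open>f\<close> can be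
chosen small enough to lose against half of that rate. The bound is uniform in both parameters, so
that \<open>ray_laplace\<close> can be differentiated along any curve in them.
\<close>

lemma ray_laplace_local_bound:
  assumes f: "slit_function a f" "a > 0" and \<eta>: "\<bar>Im \<eta>\<bar> < pi / 2" and w: "\<bar>Im (\<eta> - w)\<bar> < pi"
  obtains \<rho> C c where "\<rho> > 0" "c > 0"
    "\<And>\<eta>' w'. \<eta>' \<in> ball \<eta> \<rho> \<Longrightarrow> w' \<in> ball w \<rho> \<Longrightarrow> \<bar>Im (\<eta>' - w')\<bar> < pi"
    "\<And>\<eta>' w' s. \<eta>' \<in> ball \<eta> \<rho> \<Longrightarrow> w' \<in> ball w \<rho> \<Longrightarrow> s \<ge> 0 \<Longrightarrow>
       norm (exp (- (of_real s * exp \<eta>')) * f (of_real s * exp (\<eta>' - w')) * exp \<eta>') \<le> C * exp (- c * s)"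
proof -
  \<comment> \<open>An angle strictly between the given one and \<open>pi\<close>, leaving room for a neighbourhood.\<close>
  define \<beta> where "\<beta> = (\<bar>Im (\<eta> - w)\<bar> + pi) / 2"
  have \<beta>: "0 < \<beta>" "\<beta> < pi" "\<bar>Im (\<eta> - w)\<bar> < \<beta>" using w by (auto simp: \<beta>_def)
  define b where "b = Re (exp \<eta>) / 2"
  have b: "b > 0"
    using \<eta> by (auto simp: b_def Re_exp abs_less_iff intro!: mult_pos_pos cos_gt_zero_pi)
  define C2 where "C2 = exp (Re (\<eta> - w) + 2)"
  define C1 where "C1 = norm (exp \<eta>) + 1"
  have "\<forall>\<^sub>F x in nhds \<eta>. Re (exp x) > b"
    by (rule order_tendstoD(1)[of _ "Re (exp \<eta>)"]) (use b in \<open>auto intro!: tendsto_intros filterlim_ident simp: b_def\<close>)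
  moreover have "\<forall>\<^sub>F x in nhds \<eta>. norm (exp x) < C1"
    by (rule order_tendstoD(2)[of _ "norm (exp \<eta>)"]) (auto intro!: tendsto_intros filterlim_ident simp: C1_def)
  ultimately have "\<forall>\<^sub>F x in nhds \<eta>. Re (exp x) > b \<and> norm (exp x) < C1"
    by (rule eventually_conj)
  then obtain \<rho>1 where \<rho>1: "\<rho>1 > 0" "\<And>x. x \<in> ball \<eta> \<rho>1 \<Longrightarrow> Re (exp x) > b \<and> norm (exp x) < C1"
    by (auto simp: eventually_nhds_metric dist_commute)
  define \<rho> where "\<rho> = min \<rho>1 (min 1 ((\<beta> - \<bar>Im (\<eta> - w)\<bar>) / 2))"
  have \<rho>: "\<rho> > 0" using \<rho>1 \<beta> by (simp add: \<rho>_def)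
  \<comment> \<open>With this type \<open>f\<close> grows along the ray at most at half of the decay rate \<open>b\<close>.\<close>
  define \<epsilon> where "\<epsilon> = b / (2 * C2)"
  have \<epsilon>: "\<epsilon> > 0" using b by (simp add: \<epsilon>_def C2_def)
  obtain C where C: "C \<ge> 0" "\<And>s v. s \<ge> 0 \<Longrightarrow> \<bar>Im v\<bar> \<le> \<beta> \<Longrightarrow>
      norm (f (of_real s * exp v)) \<le> C * exp (\<epsilon> * (s * exp (Re v)))"
    using slit_function_sector_bound[OF f \<beta>(1,2) \<epsilon>] by blast
  have diff: "\<bar>Im (\<eta>' - w')\<bar> \<le> \<beta> \<and> Re (\<eta>' - w') \<le> Re (\<eta> - w) + 2"
    if "\<eta>' \<in> ball \<eta> \<rho>" "w' \<in> ball w \<rho>" for \<eta>' w'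
  proof -
    have "norm (\<eta>' - \<eta>) < \<rho>" "norm (w' - w) < \<rho>"
      using that by (auto simp: dist_norm norm_minus_commute)
    then have "norm ((\<eta>' - \<eta>) - (w' - w)) < 2 * \<rho>"
      using norm_triangle_ineq4[of "\<eta>' - \<eta>" "w' - w"] by linarith
    then have "\<bar>Im ((\<eta>' - \<eta>) - (w' - w))\<bar> < 2 * \<rho>" "\<bar>Re ((\<eta>' - \<eta>) - (w' - w))\<bar> < 2 * \<rho>"
      using abs_Im_le_cmod abs_Re_le_cmod le_less_trans by blast+
    moreover have "\<rho> \<le> min 1 ((\<beta> - \<bar>Im (\<eta> - w)\<bar>) / 2)"
      unfolding \<rho>_def by (rule min.cobounded2)
    then have "\<rho> \<le> 1" "\<rho> \<le> (\<beta> - \<bar>Im (\<eta> - w)\<bar>) / 2"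
      by (simp_all only: min.bounded_iff)
    moreover have "Im (\<eta>' - w') = Im (\<eta> - w) + Im ((\<eta>' - \<eta>) - (w' - w))"
      "Re (\<eta>' - w') = Re (\<eta> - w) + Re ((\<eta>' - \<eta>) - (w' - w))" by simp_all
    moreover have "\<bar>Im (\<eta> - w) + Im ((\<eta>' - \<eta>) - (w' - w))\<bar> \<le> \<bar>Im (\<eta> - w)\<bar> + \<bar>Im ((\<eta>' - \<eta>) - (w' - w))\<bar>"
      by (rule abs_triangle_ineq)
    ultimately show ?thesis unfolding abs_less_iff[of "Re _"] by (simp only:) (intro conjI; argo)
  qed
  show thesis
  proof (rule that[OF \<rho>, of "b / 2" "C * C1"])
    fix \<eta>' w' assume *: "\<eta>' \<in> ball \<eta> \<rho>" "w' \<in> ball w \<rho>"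
    show "\<bar>Im (\<eta>' - w')\<bar> < pi" using diff[OF *] \<beta> by linarith
    fix s :: real assume s: "s \<ge> 0"
    have r: "Re (exp \<eta>') > b" "norm (exp \<eta>') < C1" using \<rho>1 * by (auto simp: \<rho>_def)
    have "norm (f (of_real s * exp (\<eta>' - w'))) \<le> C * exp (\<epsilon> * (s * exp (Re (\<eta>' - w'))))"
      using diff[OF *] s by (intro C) auto
    also have "\<dots> \<le> C * exp (\<epsilon> * (s * C2))"
      using diff[OF *] s \<epsilon> C(1) by (simp add: C2_def mult_left_mono)
    also have "\<epsilon> * (s * C2) = b / 2 * s" by (simp add: \<epsilon>_def C2_def)
    finally have 1: "norm (f (of_real s * exp (\<eta>' - w'))) \<le> C * exp (b / 2 * s)" .
    have 2: "norm (exp (- (of_real s * exp \<eta>'))) \<le> exp (- b * s)"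
      using r s mult_right_mono[of b "Re (exp \<eta>')" s] by (simp add: mult.commute)
    have "norm (exp (- (of_real s * exp \<eta>')) * f (of_real s * exp (\<eta>' - w')) * exp \<eta>')
        \<le> exp (- b * s) * (C * exp (b / 2 * s)) * C1"
      unfolding norm_mult using 1 2 r C(1) by (intro mult_mono) auto
    also have "\<dots> = C * C1 * (exp (- b * s) * exp (b / 2 * s))" by simp
    also have "exp (- b * s) * exp (b / 2 * s) = exp (- (b / 2) * s)"
      by (simp add: exp_add[symmetric])
    finally show "norm (exp (- (of_real s * exp \<eta>')) * f (of_real s * exp (\<eta>' - w')) * exp \<eta>')
        \<le> C * C1 * exp (- (b / 2) * s)" .
  qed (use b in auto)
qed

lemma slit_function_continuous_on: "slit_function a f \<Longrightarrow> continuous_on (cut_plane a) f"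
  by (auto simp: slit_function_def intro: holomorphic_on_imp_continuous_on)

lemma ray_integrand_measurable:
  assumes f: "slit_function a f" "a > 0" and w: "\<bar>Im (\<eta> - w)\<bar> < pi"
  shows "set_borel_measurable lborel {0..}
     (\<lambda>s. exp (- (of_real s * exp \<eta>)) * f (of_real s * exp (\<eta> - w)) * exp \<eta>)"
  unfolding set_borel_measurable_def measurable_lborel2
proof (rule borel_measurable_continuous_on_indicator)
  have "continuous_on {0..} (\<lambda>s. f (of_real s * exp (\<eta> - w)))"
    by (rule continuous_on_compose2[OF slit_function_continuous_on[OF f(1)]])
      (use f w ray_in_cut_plane in \<open>auto intro!: continuous_intros\<close>)
  then show "continuous_on {0..} (\<lambda>s. exp (- (of_real s * exp \<eta>)) * f (of_real s * exp (\<eta> - w)) * exp \<eta>)"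
    by (intro continuous_intros)
qed auto

lemma ray_integrand_integrable:
  assumes f: "slit_function a f" "a > 0" and \<eta>: "\<bar>Im \<eta>\<bar> < pi / 2" and w: "\<bar>Im (\<eta> - w)\<bar> < pi"
  shows "set_integrable lborel {0..}
     (\<lambda>s. exp (- (of_real s * exp \<eta>)) * f (of_real s * exp (\<eta> - w)) * exp \<eta>)"
proof -
  obtain \<rho> C c where \<rho>: "\<rho> > 0" "c > 0"
    "\<And>\<eta>' w' s. \<eta>' \<in> ball \<eta> \<rho> \<Longrightarrow> w' \<in> ball w \<rho> \<Longrightarrow> s \<ge> 0 \<Longrightarrow>
       norm (exp (- (of_real s * exp \<eta>')) * f (of_real s * exp (\<eta>' - w')) * exp \<eta>') \<le> C * exp (- c * s)"
    using ray_laplace_local_bound[OF assms] by metis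
  have b: "norm (exp (- (of_real s * exp \<eta>)) * f (of_real s * exp (\<eta> - w)) * exp \<eta>) \<le> C * exp (- c * s)"
    if "s \<ge> 0" for s using \<rho> that by auto
  have "set_integrable lborel {0..} (\<lambda>s. C * exp (- c * s))"
    by (intro set_integrable_mult_right set_integrable_exp_minus \<rho>)
  then show ?thesis
    by (rule set_integrable_bound)
      (use ray_integrand_measurable[OF f w] b in \<open>auto simp: set_borel_measurable_def intro!: AE_I2 order_trans[OF b]\<close>)
qed

text \<open>
Stated for a curve \<open>(p x, q x)\<close> of parameters: besides the two partial derivatives, the case
\<open>p x = x + c\<close>, \<open>q x = x\<close> is needed, in which the argument of \<open>f\<close> is constant and only the exponential is
differentiated.
\<close>

lemma ray_laplace_has_field_derivative:
  fixes p q :: "complex \<Rightarrow> complex"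
  assumes f: "slit_function a f" "a > 0"
    and p: "p holomorphic_on UNIV" and q: "q holomorphic_on UNIV"
    and \<eta>: "\<bar>Im (p x)\<bar> < pi / 2" and w: "\<bar>Im (p x - q x)\<bar> < pi"
  shows "((\<lambda>x. ray_laplace f (p x) (q x)) has_field_derivative
     (LBINT s:{0..}. deriv (\<lambda>x. exp (- (of_real s * exp (p x))) * f (of_real s * exp (p x - q x)) * exp (p x)) x))
     (at x)"
proof -
  obtain \<rho> C c where \<rho>: "\<rho> > 0" "c > 0"
    "\<And>\<eta>' w'. \<eta>' \<in> ball (p x) \<rho> \<Longrightarrow> w' \<in> ball (q x) \<rho> \<Longrightarrow> \<bar>Im (\<eta>' - w')\<bar> < pi"
    "\<And>\<eta>' w' s. \<eta>' \<in> ball (p x) \<rho> \<Longrightarrow> w' \<in> ball (q x) \<rho> \<Longrightarrow> s \<ge> 0 \<Longrightarrow>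
       norm (exp (- (of_real s * exp \<eta>')) * f (of_real s * exp (\<eta>' - w')) * exp \<eta>') \<le> C * exp (- c * s)"
    using ray_laplace_local_bound[OF f \<eta> w] by metis
  define U where "U = p -` ball (p x) \<rho> \<inter> q -` ball (q x) \<rho>"
  have "open U" unfolding U_def
    using p q by (intro open_Int open_vimage holomorphic_on_imp_continuous_on) auto
  have fh: "f holomorphic_on cut_plane a" using f by (simp add: slit_function_def)
  show ?thesis unfolding ray_laplace_def
  proof (rule holomorphic_parametric_integral[OF _ \<open>open U\<close>, where G = "\<lambda>s. C * exp (- c * s)"])
    show "(\<lambda>x. exp (- (of_real s * exp (p x))) * f (of_real s * exp (p x - q x)) * exp (p x)) holomorphic_on U"
      if "s \<in> {0..}" for s
    proof -
      have pq: "p holomorphic_on U" "q holomorphic_on U" using p q by (auto intro: holomorphic_on_subset)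
      have "(f \<circ> (\<lambda>x. of_real s * exp (p x - q x))) holomorphic_on U"
        by (rule holomorphic_on_compose_gen[OF _ fh])
          (use \<rho> that f pq in \<open>auto intro!: holomorphic_intros ray_in_cut_plane simp: U_def\<close>)
      then show ?thesis using pq by (auto intro!: holomorphic_intros simp: o_def)
    qed
    show "set_borel_measurable lborel {0..}
      (\<lambda>s. exp (- (of_real s * exp (p x))) * f (of_real s * exp (p x - q x)) * exp (p x))" if "x \<in> U" for x
      using that \<rho> by (intro ray_integrand_measurable[OF f]) (auto simp: U_def)
    show "set_integrable lborel {0..} (\<lambda>s. C * exp (- c * s))"
      by (intro set_integrable_mult_right set_integrable_exp_minus \<rho>)
  qed (use \<rho> in \<open>auto simp: U_def\<close>)
qed

text \<open>
A real \<open>\<eta>\<close> only rescales the variable of integration.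
\<close>

lemma ray_laplace_real_shift:
  assumes "Im \<eta> = 0"
  shows "ray_laplace f \<eta> w = ray_laplace f 0 w"
proof -
  define c where "c = exp (Re \<eta>)"
  have c: "c > 0" "exp \<eta> = of_real c"
    using assms by (auto simp: c_def exp_eq_polar complex_eq_iff Re_exp Im_exp)
  define F where "F s = indicator {0..} s *\<^sub>R (exp (- of_real s) * f (of_real s * exp (- w)))" for s :: real
  have "ray_laplace f \<eta> w = (LBINT s. c *\<^sub>R F (0 + c * s))"
    unfolding ray_laplace_def set_lebesgue_integral_def F_def
    using c by (intro Bochner_Integration.integral_cong refl)
      (auto simp: indicator_def zero_le_mult_iff exp_diff exp_minus field_simps scaleR_conv_of_real)
  also have "\<dots> = \<bar>c\<bar> *\<^sub>R (LBINT s. F (0 + c * s))" using c by simp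
  also have "\<dots> = (LBINT s. F s)"
    using c by (subst lborel_integral_real_affine[of c F 0]) auto
  also have "\<dots> = ray_laplace f 0 w"
    by (simp add: ray_laplace_def set_lebesgue_integral_def F_def)
  finally show ?thesis .
qed

text \<open>
Rotation of the contour without Cauchy's theorem: the integral is holomorphic in \<open>\<eta>\<close> on a convex
strip and constant for real \<open>\<eta>\<close>, hence constant.
\<close>

lemma ray_laplace_rotate:
  assumes f: "slit_function a f" "a > 0"
    and w: "\<bar>Im w\<bar> < pi" and \<eta>: "\<bar>Im \<eta>\<bar> < pi / 2" "\<bar>Im (\<eta> - w)\<bar> < pi"
  shows "ray_laplace f \<eta> w = ray_laplace f 0 w"
proof -
  define U where "U = {\<eta>. \<bar>Im \<eta>\<bar> < pi / 2 \<and> \<bar>Im (\<eta> - w)\<bar> < pi}"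
  have Ueq: "U = {\<eta>. Im \<eta> < min (pi / 2) (pi + Im w)} \<inter> {\<eta>. Im \<eta> > max (- pi / 2) (Im w - pi)}"
    by (auto simp: U_def abs_less_iff)
  have "open U" unfolding Ueq by (intro open_Int open_halfspace_Im_lt open_halfspace_Im_gt)
  have "connected U" unfolding Ueq
    by (intro convex_connected convex_Int convex_halfspace_Im_lt convex_halfspace_Im_gt)
  have hol: "(\<lambda>\<eta>. ray_laplace f \<eta> w) holomorphic_on U"
    unfolding holomorphic_on_open[OF \<open>open U\<close>]
    using ray_laplace_has_field_derivative[OF f, of "\<lambda>\<eta>. \<eta>" "\<lambda>_. w"]
    by (fastforce simp: U_def)
  have hol2: "(\<lambda>\<eta>. ray_laplace f \<eta> w - ray_laplace f 0 w) holomorphic_on U"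
    using hol by (intro holomorphic_intros)
  have "ray_laplace f \<eta> w - ray_laplace f 0 w = 0"
  proof (rule analytic_continuation[OF hol2 \<open>open U\<close> \<open>connected U\<close>, of \<real> 0])
    show "\<real> \<subseteq> U" using w by (auto simp: U_def complex_is_Real_iff)
    show "0 \<in> U" using w by (auto simp: U_def)
    show "(0::complex) islimpt \<real>"
      unfolding islimpt_approachable
    proof (intro allI impI)
      fix e :: real assume "e > 0"
      then show "\<exists>x'\<in>\<real>. x' \<noteq> (0::complex) \<and> dist x' 0 < e"
        by (intro bexI[of _ "of_real (e / 2)"]) auto
    qed
    show "ray_laplace f z w - ray_laplace f 0 w = 0" if "z \<in> \<real>" for z
      using that ray_laplace_real_shift[of z f w] by (simp add: complex_is_Real_iff)
    show "\<eta> \<in> U" using \<eta> by (simp add: U_def)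
  qed
  then show ?thesis by simp
qed

lemma ray_laplace_holomorphic:
  assumes f: "slit_function a f" "a > 0" and \<eta>: "\<bar>Im \<eta>\<bar> < pi / 2"
  shows "ray_laplace f \<eta> holomorphic_on {w. \<bar>Im (\<eta> - w)\<bar> < pi}"
proof -
  have "{w. \<bar>Im (\<eta> - w)\<bar> < pi} = {w. Im w < Im \<eta> + pi} \<inter> {w. Im w > Im \<eta> - pi}"
    by (auto simp: abs_less_iff)
  then have o: "open {w. \<bar>Im (\<eta> - w)\<bar> < pi}"
    by (simp add: open_Int open_halfspace_Im_lt open_halfspace_Im_gt)
  show ?thesis unfolding holomorphic_on_open[OF o]
    using ray_laplace_has_field_derivative[OF f, of "\<lambda>_. \<eta>" "\<lambda>w. w"] \<eta>
    by fastforce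
qed

section \<open>Growth of the functions in the space\<close>

lemma bounded_on_compact_if_locally_bounded:
  fixes f :: "'a::topological_space \<Rightarrow> 'b::real_normed_vector"
  assumes "compact K"
    and loc: "\<And>x. x \<in> K \<Longrightarrow> \<exists>U B. open U \<and> x \<in> U \<and> (\<forall>y\<in>U \<inter> S. norm (f y) \<le> B)"
  obtains B where "\<And>y. y \<in> K \<inter> S \<Longrightarrow> norm (f y) \<le> B"
proof -
  obtain U B where UB: "\<And>x. x \<in> K \<Longrightarrow> open (U x) \<and> x \<in> U x \<and> (\<forall>y\<in>U x \<inter> S. norm (f y) \<le> B x)"
    using loc by metis
  obtain D where D: "D \<subseteq> K" "finite D" "K \<subseteq> (\<Union>x\<in>D. U x)"
    by (rule compactE_image[OF \<open>compact K\<close>, of K U]) (use UB in auto)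
  have "norm (f y) \<le> (\<Sum>x\<in>D. \<bar>B x\<bar>)" if y: "y \<in> K \<inter> S" for y
  proof -
    obtain x where x: "x \<in> D" "y \<in> U x" using D y by blast
    then have "norm (f y) \<le> B x" using UB[of x] D y by auto
    also have "\<dots> \<le> \<bar>B x\<bar>" by simp
    also have "\<dots> \<le> (\<Sum>x\<in>D. \<bar>B x\<bar>)"
      using x D by (intro member_le_sum) auto
    finally show ?thesis .
  qed
  then show thesis using that by blast
qed

text \<open>
The growth condition from its ingredients at infinity, at the tip and at the cut. What is left is a
compact set away from the tip, where boundedness is a local question, including at the points of the
cut.
\<close>

lemma slit_functionI:
  assumes a: "a > 0" and hol: "f holomorphic_on cut_plane a"
    and growth: "\<And>\<epsilon>. \<epsilon> > 0 \<Longrightarrow> \<exists>K R. \<forall>t\<in>cut_plane a. norm t > R \<longrightarrow> norm (f t) \<le> K * exp (\<epsilon> * norm t)"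
    and tip: "\<delta> > 0" "\<And>t. t \<in> cut_plane a \<Longrightarrow> norm (t + of_real a) < \<delta> \<Longrightarrow> norm (f t) \<le> C / sqrt (norm (t + of_real a))"
    and bank: "\<And>s. s > 0 \<Longrightarrow> \<exists>U B. open U \<and> - of_real (a + s) \<in> U \<and> (\<forall>y\<in>U \<inter> cut_plane a. norm (f y) \<le> B)"
  shows "slit_function a f"
  unfolding slit_function_def
proof (intro conjI hol allI impI)
  fix \<epsilon> :: real assume \<epsilon>: "\<epsilon> > 0"
  obtain K R where K: "\<And>t. t \<in> cut_plane a \<Longrightarrow> norm t > R \<Longrightarrow> norm (f t) \<le> K * exp (\<epsilon> * norm t)"
    using growth[OF \<epsilon>] by blast
  have "\<exists>U B. open U \<and> x \<in> U \<and> (\<forall>y\<in>U \<inter> cut_plane a. norm (f y) \<le> B)"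
    if x: "x \<noteq> - of_real a" for x
  proof (cases "x \<in> cut_plane a")
    case True
    then have "isCont f x"
      using hol open_cut_plane holomorphic_on_imp_continuous_on continuous_on_eq_continuous_at by blast
    then have "\<forall>\<^sub>F y in nhds x. dist (f y) (f x) < 1"
      using tendstoD[of f "f x" "nhds x" 1] by (simp add: isCont_def tendsto_nhds_iff)
    then obtain U where U: "open U" "x \<in> U" "\<And>y. y \<in> U \<Longrightarrow> dist (f y) (f x) < 1"
      by (auto simp: eventually_nhds)
    have "norm (f y) \<le> norm (f x) + 1" if "y \<in> U" for y
      using U(3)[OF that] norm_triangle_sub[of "f y" "f x"] by (simp add: dist_norm)
    then show ?thesis using U by blast
  next
    case False
    then obtain y where y: "y \<le> -a" "x = of_real y" by (auto simp: cut_plane_def)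
    with x have "y \<noteq> -a" by auto
    with y bank[of "- a - y"] show ?thesis by simp
  qed
  moreover have "compact (cball 0 R - ball (- of_real a) \<delta> :: complex set)"
    by (intro compact_diff) auto
  ultimately obtain B where B:
    "\<And>t. t \<in> (cball 0 R - ball (- of_real a) \<delta>) \<inter> cut_plane a \<Longrightarrow> norm (f t) \<le> B"
    using tip(1) bounded_on_compact_if_locally_bounded[of "cball 0 R - ball (- of_real a) \<delta>" "cut_plane a" f]
    by (metis DiffD2 centre_in_ball)
  show "\<exists>C. \<forall>t\<in>cut_plane a. norm (f t) \<le> C * (1 + 1 / sqrt (norm (t + of_real a))) * exp (\<epsilon> * norm t)"
  proof (intro exI[of _ "\<bar>K\<bar> + \<bar>B\<bar> + \<bar>C\<bar>"] ballI)
    fix t assume t: "t \<in> cut_plane a"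
    let ?x = "1 / sqrt (norm (t + of_real a))" and ?e = "exp (\<epsilon> * norm t)"
    have x: "?x \<ge> 0" and e: "?e \<ge> 1" using \<epsilon> by auto
    have xe: "1 \<le> (1 + ?x) * ?e" "?e \<le> (1 + ?x) * ?e" "?x \<le> (1 + ?x) * ?e"
      using x e mult_mono[of 1 "1 + ?x" 1 ?e] mult_mono[of ?x "1 + ?x" 1 ?e] mult_mono[of 1 "1 + ?x" ?e ?e]
      by auto
    consider "norm t > R" | "norm (t + of_real a) < \<delta>" | "norm t \<le> R" "norm (t + of_real a) \<ge> \<delta>"
      by linarith
    then have "norm (f t) \<le> \<bar>K\<bar> * ?e \<or> norm (f t) \<le> \<bar>C\<bar> * ?x \<or> norm (f t) \<le> \<bar>B\<bar> * 1"
    proof cases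
      case 1
      then show ?thesis
        using K[OF t] by (meson abs_ge_self exp_ge_zero mult_right_mono order_trans)
    next
      case 2
      then have "norm (f t) \<le> C * ?x" using tip(2)[OF t] by simp
      also have "\<dots> \<le> \<bar>C\<bar> * ?x" using x by (intro mult_right_mono) auto
      finally show ?thesis by simp
    next
      case 3
      then have "norm (f t) \<le> B"
        using t by (intro B) (auto simp: dist_norm norm_minus_commute add.commute)
      then show ?thesis by (intro disjI2) simp
    qed
    moreover have "\<bar>K\<bar> * ?e \<le> \<bar>K\<bar> * ((1 + ?x) * ?e)" "\<bar>C\<bar> * ?x \<le> \<bar>C\<bar> * ((1 + ?x) * ?e)"
      "\<bar>B\<bar> * 1 \<le> \<bar>B\<bar> * ((1 + ?x) * ?e)"
      using xe by (intro mult_left_mono; simp)+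
    moreover have "0 \<le> \<bar>K\<bar> * ((1 + ?x) * ?e)" "0 \<le> \<bar>C\<bar> * ((1 + ?x) * ?e)"
      "0 \<le> \<bar>B\<bar> * ((1 + ?x) * ?e)" using x by auto
    ultimately have "norm (f t) \<le> \<bar>K\<bar> * ((1 + ?x) * ?e) + \<bar>B\<bar> * ((1 + ?x) * ?e) + \<bar>C\<bar> * ((1 + ?x) * ?e)"
      by linarith
    then show "norm (f t) \<le> (\<bar>K\<bar> + \<bar>B\<bar> + \<bar>C\<bar>) * (1 + ?x) * ?e"
      by (simp only: distrib_right mult.assoc)
  qed
qed

text \<open>
Divided differences inherit the growth condition: they are bounded near \<open>t\<close>, and away from \<open>t\<close> the
denominator is bounded below.
\<close>

lemma slit_function_divided_difference:
  assumes f: "slit_function a f" and t: "t \<in> cut_plane a"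
  shows "slit_function a (\<lambda>s. if s = t then deriv f t else (f s - f t) / (s - t))" (is "slit_function a ?D")
proof -
  have hol: "?D holomorphic_on cut_plane a"
    using f t open_cut_plane by (intro pole_lemma) (auto simp: slit_function_def interior_open)
  obtain \<rho> where \<rho>: "\<rho> > 0" "cball t \<rho> \<subseteq> cut_plane a"
    using t open_cut_plane open_contains_cball by blast
  have "bounded (?D ` cball t \<rho>)"
    using hol \<rho> by (intro compact_imp_bounded compact_continuous_image)
      (auto intro: holomorphic_on_imp_continuous_on holomorphic_on_subset)
  then obtain B where B: "\<And>s. s \<in> cball t \<rho> \<Longrightarrow> norm (?D s) \<le> B"
    unfolding bounded_iff by blast
  show ?thesis unfolding slit_function_def
  proof (intro conjI hol allI impI)
    fix \<epsilon> :: real assume \<epsilon>: "\<epsilon> > 0"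
    obtain C where C: "\<And>t. t \<in> cut_plane a \<Longrightarrow>
        norm (f t) \<le> C * (1 + 1 / sqrt (norm (t + of_real a))) * exp (\<epsilon> * norm t)"
      using f \<epsilon> unfolding slit_function_def by blast
    show "\<exists>C. \<forall>s\<in>cut_plane a. norm (?D s) \<le> C * (1 + 1 / sqrt (norm (s + of_real a))) * exp (\<epsilon> * norm s)"
    proof (intro exI[of _ "\<bar>B\<bar> + (\<bar>C\<bar> + norm (f t)) / \<rho>"] ballI)
      fix s assume s: "s \<in> cut_plane a"
      define X where "X = (1 + 1 / sqrt (norm (s + of_real a))) * exp (\<epsilon> * norm s)"
      have X: "X \<ge> 1"
        unfolding X_def using \<epsilon> mult_mono[of 1 "1 + 1 / sqrt (norm (s + of_real a))" 1 "exp (\<epsilon> * norm s)"] by auto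
      have nonneg: "0 \<le> \<bar>B\<bar> * X" "0 \<le> (\<bar>C\<bar> + norm (f t)) / \<rho> * X"
        using X \<rho> by (auto intro!: mult_nonneg_nonneg divide_nonneg_pos)
      have "norm (?D s) \<le> \<bar>B\<bar> * X + (\<bar>C\<bar> + norm (f t)) / \<rho> * X"
      proof (cases "s \<in> cball t \<rho>")
        case True
        then have "norm (?D s) \<le> \<bar>B\<bar> * 1" using B by fastforce
        also have "\<dots> \<le> \<bar>B\<bar> * X" using X by (intro mult_left_mono) auto
        finally show ?thesis using nonneg by linarith
      next
        case False
        then have far: "norm (s - t) > \<rho>" by (auto simp: dist_norm norm_minus_commute)
        have "norm (f s) \<le> C * X" using C[OF s] by (simp add: X_def mult.assoc)
        also have "\<dots> \<le> \<bar>C\<bar> * X" using X by (intro mult_right_mono) auto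
        finally have 1: "norm (f s) \<le> \<bar>C\<bar> * X" .
        have 2: "norm (f t) \<le> norm (f t) * X" using X by (simp add: mult_le_cancel_left1)
        have "norm (f s - f t) \<le> (\<bar>C\<bar> + norm (f t)) * X"
          using 1 2 norm_triangle_ineq4[of "f s" "f t"] by (simp add: distrib_right)
        then have "norm (f s - f t) / norm (s - t) \<le> (\<bar>C\<bar> + norm (f t)) * X / \<rho>"
          using far \<rho> X by (intro frac_le) auto
        then have "norm (?D s) \<le> (\<bar>C\<bar> + norm (f t)) / \<rho> * X"
          using far \<rho> by (auto simp: norm_divide)
        then show ?thesis using nonneg by linarith
      qed
      then show "norm (?D s) \<le> (\<bar>B\<bar> + (\<bar>C\<bar> + norm (f t)) / \<rho>) *
          (1 + 1 / sqrt (norm (s + of_real a))) * exp (\<epsilon> * norm s)"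
        by (simp only: distrib_right mult.assoc X_def)
    qed
  qed
qed

text \<open>
The condition of minimal type speaks of all branches on all sectorial regions. The branch on the cut
plane itself is the one over \<open>- pi < arg t < pi\<close>, reached by a constant path.
\<close>

lemma H_space_growth:
  assumes F: "F \<in> H_space a T" and a: "a > 0" and \<epsilon>: "\<epsilon> > 0"
  shows "\<exists>K R. \<forall>t\<in>cut_plane a. norm t > R \<longrightarrow> norm (F t) \<le> K * exp (\<epsilon> * norm t)"
proof -
  have hol: "F holomorphic_on cut_plane a" and mt: "minimal_type_at_infinity a F"
    using F by (auto simp: H_space_def)
  have sec: "exp w \<in> cut_plane a" if "\<bar>Im w\<bar> < pi" for w
    using ray_in_cut_plane[OF a, of 1 w] that by simp
  have "branch_on_log_sector a F a (- pi) pi (\<lambda>w. F (exp w))"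
    unfolding branch_on_log_sector_def
  proof (intro conjI exI bexI)
    have "(F \<circ> exp) holomorphic_on log_sector a (- pi) pi"
      by (rule holomorphic_on_compose_gen[OF _ hol])
        (auto intro!: holomorphic_intros sec simp: log_sector_def)
    then show "(\<lambda>w. F (exp w)) holomorphic_on log_sector a (- pi) pi" by (simp add: o_def)
    let ?w = "of_real (ln (2 * a)) :: complex"
    have e: "exp ?w = of_real (2 * a)" using a by (metis exp_ln exp_of_real mult_pos_pos zero_less_numeral)
    have c: "of_real (2 * a) \<in> cut_plane a" using sec[of ?w] e by simp
    show "?w \<in> log_sector a (- pi) pi" using a by (simp add: log_sector_def e del: of_real_mult)
    show "admissible_path a (\<lambda>_. of_real (2 * a))"
      using a c by (auto simp: admissible_path_def path_def path_image_def pathstart_def complex_eq_iff)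
    show "analytic_continuation_along F (\<lambda>_. of_real (2 * a)) (\<lambda>_. F)"
    proof -
      have "F analytic_on cut_plane a" using hol open_cut_plane by (simp add: analytic_on_open)
      then have "F analytic_on {of_real (2 * a)}" using c by (auto intro: analytic_on_subset)
      then show ?thesis by (simp add: analytic_continuation_along_def)
    qed
    show "pathfinish (\<lambda>_. of_real (2 * a)) = exp ?w" by (simp add: pathfinish_def e)
  qed auto
  then obtain K R where R: "R \<ge> a" and K: "\<And>w. w \<in> log_sector R (- pi) pi \<Longrightarrow>
      norm (F (exp w)) \<le> K * exp (\<epsilon> * norm (exp w))"
    using mt \<epsilon> unfolding minimal_type_at_infinity_def by blast
  have "norm (F t) \<le> K * exp (\<epsilon> * norm t)" if t: "t \<in> cut_plane a" "norm t > R" for t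
  proof -
    have "t \<noteq> 0" using t R a by auto
    have "Im (Ln t) \<noteq> pi"
    proof
      assume "Im (Ln t) = pi"
      then have "Re t < 0" "Im t = 0" using Im_Ln_eq_pi[OF \<open>t \<noteq> 0\<close>] by auto
      then have "t = of_real (Re t)" "norm t = - Re t" by (auto simp: complex_eq_iff cmod_eq_Re)
      then show False using t R by (auto simp: cut_plane_def image_iff)
    qed
    then have "Ln t \<in> log_sector R (- pi) pi"
      using t \<open>t \<noteq> 0\<close> mpi_less_Im_Ln[of t] Im_Ln_le_pi[of t] by (auto simp: log_sector_def)
    then show ?thesis using K[of "Ln t"] \<open>t \<noteq> 0\<close> by simp
  qed
  then show ?thesis by blast
qed

text \<open>
From \<open>- ln x = 2 * ln (1 / sqrt x) \<le> 2 / sqrt x\<close>; the imaginary part costs \<open>pi \<le> pi / sqrt x\<close>.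
\<close>

lemma norm_Ln_le:
  assumes "z \<noteq> 0" "norm z \<le> 1"
  shows "norm (Ln z) \<le> (2 + pi) / sqrt (norm z)"
proof -
  have z: "norm z > 0" using assms by simp
  have "norm (Ln z) \<le> \<bar>Re (Ln z)\<bar> + \<bar>Im (Ln z)\<bar>" by (rule cmod_le)
  also have "\<bar>Im (Ln z)\<bar> \<le> pi" using mpi_less_Im_Ln[of z] Im_Ln_le_pi[of z] assms by auto
  also have "\<bar>Re (Ln z)\<bar> = - ln (norm z)" using assms z by (simp add: ln_le_zero_iff)
  also have "- ln (norm z) = 2 * ln (1 / sqrt (norm z))" using z by (simp add: ln_div ln_sqrt)
  also have "\<dots> \<le> 2 * (1 / sqrt (norm z))" using z ln_le_minus_one[of "1 / sqrt (norm z)"] by simp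
  also have "pi \<le> pi * (1 / sqrt (norm z))"
    using assms z by (simp add: field_simps)
  finally show ?thesis by (simp add: add_divide_distrib)
qed

lemma H_space_slit_function:
  assumes F: "F \<in> H_space a T" and a: "a > 0"
  shows "slit_function a F"
proof -
  have hol: "F holomorphic_on cut_plane a" using F by (simp add: H_space_def)
  have "F \<in> O[at (- of_real a) within cut_disc a](\<lambda>t. Ln (t + of_real a))"
    using F by (simp add: H_space_def)
  then obtain c where "c > 0"
    and c: "\<forall>\<^sub>F t in at (- of_real a) within cut_disc a. norm (F t) \<le> c * norm (Ln (t + of_real a))"
    by (elim landau_o.bigE)
  then obtain d where d: "d > 0" "\<And>t. t \<in> cut_disc a \<Longrightarrow> t \<noteq> - of_real a \<Longrightarrow> dist t (- of_real a) < d \<Longrightarrow>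
      norm (F t) \<le> c * norm (Ln (t + of_real a))"
    unfolding eventually_at by auto
  show ?thesis
  proof (rule slit_functionI[OF a hol H_space_growth[OF F a]])
    show "min d (min a 1) > 0" using d a by simp
    fix t assume t: "t \<in> cut_plane a" "norm (t + of_real a) < min d (min a 1)"
    have ne: "t + of_real a \<noteq> 0" using t
      by (auto simp: cut_plane_def eq_neg_iff_add_eq_0[symmetric])
    have "Arg (t + of_real a) \<noteq> pi"
    proof
      assume "Arg (t + of_real a) = pi"
      then have "t = of_real (Re t)" "Re t \<le> - a"
        by (auto simp: Arg_eq_pi complex_eq_iff)
      then show False using t by (auto simp: cut_plane_def image_iff)
    qed
    then have "t \<in> cut_disc a"
      using t ne Arg_bounded[of "t + of_real a"] by (auto simp: cut_disc_def abs_less_iff eq_neg_iff_add_eq_0)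
    then have "norm (F t) \<le> c * norm (Ln (t + of_real a))"
      using t ne by (intro d) (auto simp: dist_norm eq_neg_iff_add_eq_0)
    also have "\<dots> \<le> c * ((2 + pi) / sqrt (norm (t + of_real a)))"
      using t ne \<open>c > 0\<close> by (intro mult_left_mono norm_Ln_le) auto
    finally show "norm (F t) \<le> (c * (2 + pi)) / sqrt (norm (t + of_real a))" by simp
  next
    fix s :: real assume "s > 0"
    let ?p = "- of_real (a + s) :: complex"
    obtain u l where ul: "(F \<longlongrightarrow> u) (at ?p within {t. Im t > 0})" "(F \<longlongrightarrow> l) (at ?p within {t. Im t < 0})"
      using F \<open>s > 0\<close> unfolding H_space_def by blast
    obtain d1 where d1: "d1 > 0" "\<And>y. Im y > 0 \<Longrightarrow> y \<noteq> ?p \<Longrightarrow> dist y ?p < d1 \<Longrightarrow> dist (F y) u < 1"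
      using tendstoD[OF ul(1), of 1] unfolding eventually_at by auto
    obtain d2 where d2: "d2 > 0" "\<And>y. Im y < 0 \<Longrightarrow> y \<noteq> ?p \<Longrightarrow> dist y ?p < d2 \<Longrightarrow> dist (F y) l < 1"
      using tendstoD[OF ul(2), of 1] unfolding eventually_at by auto
    have "norm (F y) \<le> norm u + norm l + 1"
      if y: "y \<in> ball ?p (min (min d1 d2) s)" "y \<in> cut_plane a" for y
    proof -
      have "Im y \<noteq> 0"
      proof
        assume "Im y = 0"
        then have "y = of_real (Re y)" by (simp add: complex_eq_iff)
        moreover have "\<bar>Re (y - ?p)\<bar> < s"
          using y abs_Re_le_cmod[of "y - ?p"] by (simp add: dist_norm norm_minus_commute)
        ultimately show False using y(2) by (auto simp: cut_plane_def image_iff)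
      qed
      then consider "Im y > 0" | "Im y < 0" by linarith
      then show ?thesis
      proof cases
        case 1
        then have "dist (F y) u < 1" using y by (intro d1) (auto simp: dist_commute)
        then show ?thesis using norm_triangle_sub[of "F y" u] norm_ge_zero[of l] unfolding dist_norm by linarith
      next
        case 2
        then have "dist (F y) l < 1" using y by (intro d2) (auto simp: dist_commute)
        then show ?thesis using norm_triangle_sub[of "F y" l] norm_ge_zero[of u] unfolding dist_norm by linarith
      qed
    qed
    then show "\<exists>U B. open U \<and> ?p \<in> U \<and> (\<forall>y\<in>U \<inter> cut_plane a. norm (F y) \<le> B)"
      using d1 d2 \<open>s > 0\<close>
      by (intro exI[of _ "ball ?p (min (min d1 d2) s)"] exI[of _ "norm u + norm l + 1"]) auto
  qed
qed

section \<open>Continuation of the Laplace transform\<close>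

text \<open>
Rays at the angles \<open>\<plusminus>pi / 4\<close> continue the transform to \<open>- 3 * pi / 4 < Im w < 5 * pi / 4\<close> and to the
reflected strip. They agree with the central integral for \<open>\<bar>Im w\<bar> < pi\<close>, so together they give a
function that is analytic beyond the closed strip, and the description by choice is not vacuous. The
chosen function is then identified on the open strip by the identity theorem.
\<close>

lemma laplace_log_continuation:
  assumes f: "slit_function a f" "a > 0"
  shows "laplace_log f analytic_on {w. \<bar>Im w\<bar> \<le> pi}"
    and "\<And>w. \<bar>Im w\<bar> < pi / 2 \<Longrightarrow>
          laplace_log f w = exp w * (LBINT t:{0..}. exp (- exp w * of_real t) * f (of_real t))"
    and "\<And>w. \<bar>Im w\<bar> < pi \<Longrightarrow> laplace_log f w = ray_laplace f 0 w"
proof -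
  have central: "ray_laplace f 0 w = exp w * (LBINT t:{0..}. exp (- exp w * of_real t) * f (of_real t))"
    if "\<bar>Im w\<bar> < pi / 2" for w
    using that ray_laplace_rotate[OF f, of w w] by (simp add: ray_laplace_def mult.commute)
  define \<eta> where "\<eta> = of_real (pi / 4) * \<i>"
  have \<eta>: "Im \<eta> = pi / 4" "Im (- \<eta>) = - pi / 4" "\<bar>Im \<eta>\<bar> < pi / 2" "\<bar>Im (- \<eta>)\<bar> < pi / 2"
    by (simp_all add: \<eta>_def)
  define Q where "Q w = (if 0 \<le> Im w then ray_laplace f \<eta> w else ray_laplace f (- \<eta>) w)" for w
  have Qr: "Q w = ray_laplace f 0 w" if "\<bar>Im w\<bar> < pi" for w
    using that ray_laplace_rotate[OF f, of w \<eta>] ray_laplace_rotate[OF f, of w "- \<eta>"] \<eta>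
    by (auto simp: Q_def abs_less_iff)
  have 1: "Q holomorphic_on {w. \<bar>Im (\<eta> - w)\<bar> < pi}"
  proof (rule holomorphic_transform[OF ray_laplace_holomorphic[OF f, of \<eta>]])
    show "ray_laplace f \<eta> w = Q w" if "w \<in> {w. \<bar>Im (\<eta> - w)\<bar> < pi}" for w
      using that \<eta> ray_laplace_rotate[OF f, of w \<eta>] Qr[of w] by (cases "0 \<le> Im w") (auto simp: Q_def abs_less_iff)
  qed (use \<eta> in simp_all)
  have 2: "Q holomorphic_on {w. \<bar>Im (- \<eta> - w)\<bar> < pi}"
  proof (rule holomorphic_transform[OF ray_laplace_holomorphic[OF f, of "- \<eta>"]])
    show "ray_laplace f (- \<eta>) w = Q w" if "w \<in> {w. \<bar>Im (- \<eta> - w)\<bar> < pi}" for w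
      using that \<eta> ray_laplace_rotate[OF f, of w "- \<eta>"] Qr[of w] by (cases "0 \<le> Im w") (auto simp: Q_def abs_less_iff)
  qed (use \<eta> in simp_all)
  have strip: "open {w. \<bar>Im (c - w)\<bar> < pi}" for c
  proof -
    have "{w. \<bar>Im (c - w)\<bar> < pi} = {w. Im w < Im c + pi} \<inter> {w. Im w > Im c - pi}"
      by (auto simp: abs_less_iff)
    then show ?thesis by (simp add: open_Int open_halfspace_Im_lt open_halfspace_Im_gt)
  qed
  have "Q analytic_on {w. \<bar>Im (\<eta> - w)\<bar> < pi} \<union> {w. \<bar>Im (- \<eta> - w)\<bar> < pi}"
    using 1 2 strip by (simp only: analytic_on_Un analytic_on_open)
  then have "Q analytic_on {w. \<bar>Im w\<bar> \<le> pi}"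
    by (rule analytic_on_subset) (use \<eta> in \<open>auto simp: abs_less_iff abs_le_iff\<close>)
  moreover have "\<forall>w. \<bar>Im w\<bar> < pi / 2 \<longrightarrow>
      Q w = exp w * (LBINT t:{0..}. exp (- exp w * of_real t) * f (of_real t))"
    using Qr central by auto
  ultimately have ex: "\<exists>Q. Q analytic_on {w. \<bar>Im w\<bar> \<le> pi} \<and> (\<forall>w. \<bar>Im w\<bar> < pi / 2 \<longrightarrow>
      Q w = exp w * (LBINT t:{0..}. exp (- exp w * of_real t) * f (of_real t)))" by blast
  show A: "laplace_log f analytic_on {w. \<bar>Im w\<bar> \<le> pi}"
    and B: "\<And>w. \<bar>Im w\<bar> < pi / 2 \<Longrightarrow>
          laplace_log f w = exp w * (LBINT t:{0..}. exp (- exp w * of_real t) * f (of_real t))"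
    using someI_ex[OF ex] unfolding laplace_log_def by blast+
  show "laplace_log f w = ray_laplace f 0 w" if w: "\<bar>Im w\<bar> < pi" for w
  proof (rule analytic_continuation_open[of "{w. \<bar>Im w\<bar> < pi / 2}" "{w. \<bar>Im w\<bar> < pi}" "laplace_log f" "ray_laplace f 0"])
    have e: "{w. \<bar>Im w\<bar> < c} = {w. Im w < c} \<inter> {w. Im w > - c}" for c by (auto simp: abs_less_iff)
    show "open {w. \<bar>Im w\<bar> < pi / 2}" "open {w. \<bar>Im w\<bar> < pi}"
      unfolding e by (intro open_Int open_halfspace_Im_lt open_halfspace_Im_gt)+
    show "connected {w. \<bar>Im w\<bar> < pi}"
      unfolding e by (intro convex_connected convex_Int convex_halfspace_Im_lt convex_halfspace_Im_gt)
    have "0 \<in> {w. \<bar>Im w\<bar> < pi / 2}" by simp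
    then show "{w. \<bar>Im w\<bar> < pi / 2} \<noteq> {}" by blast
    show "laplace_log f holomorphic_on {w. \<bar>Im w\<bar> < pi}"
      using A by (intro analytic_imp_holomorphic) (auto intro: analytic_on_subset)
    show "ray_laplace f 0 holomorphic_on {w. \<bar>Im w\<bar> < pi}"
      using ray_laplace_holomorphic[OF f, of 0] by simp
    show "laplace_log f z = ray_laplace f 0 z" if "z \<in> {w. \<bar>Im w\<bar> < pi / 2}" for z
      using that B central by simp
  qed (use w in auto)
qed

section \<open>The expansion at the end of the cut\<close>

text \<open>
The limits of a function along a dense set depend continuously on the point. Used to fill in the
boundary values on the cut.
\<close>

lemma continuous_on_limits:
  fixes f g :: "'a::metric_space \<Rightarrow> 'b::metric_space"
  assumes lim: "\<And>x. x \<in> A \<Longrightarrow> (f \<longlongrightarrow> g x) (at x within S)"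
    and dense: "\<And>x. x \<in> A \<Longrightarrow> x islimpt S"
  shows "continuous_on A g"
  unfolding continuous_on_iff
proof (intro ballI allI impI)
  fix x e :: _ assume x: "x \<in> A" and e: "e > (0::real)"
  have "\<forall>\<^sub>F y in at x within S. dist (f y) (g x) < e / 2"
    using lim[OF x] e by (intro tendstoD) auto
  then obtain d where d: "d > 0" "\<And>y. y \<in> S \<Longrightarrow> y \<noteq> x \<Longrightarrow> dist y x < d \<Longrightarrow> dist (f y) (g x) < e / 2"
    unfolding eventually_at by auto
  show "\<exists>d>0. \<forall>x'\<in>A. dist x' x < d \<longrightarrow> dist (g x') (g x) < e"
  proof (intro exI[of _ d] conjI ballI impI d(1))
    fix y assume y: "y \<in> A" "dist y x < d"
    show "dist (g y) (g x) < e"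
    proof (cases "y = x")
      case False
      have "\<forall>\<^sub>F z in at y within S. z \<in> S \<and> z \<noteq> x \<and> dist z x < d"
        unfolding eventually_at
      proof (intro exI[of _ "min (dist y x) (d - dist y x)"] conjI ballI impI)
        fix z assume "z \<in> S" "z \<noteq> y \<and> dist z y < min (dist y x) (d - dist y x)"
        then show "z \<in> S" "z \<noteq> x" "dist z x < d"
          using dist_triangle[of z x y] by (auto simp: dist_commute)
      qed (use y False in auto)
      then have "\<forall>\<^sub>F z in at y within S. dist (f z) (g x) \<le> e / 2"
        by eventually_elim (use d in \<open>auto simp: dist_commute less_imp_le\<close>)
      moreover have "at y within S \<noteq> bot"
        using dense[OF y(1)] by (simp add: trivial_limit_within)
      moreover have "((\<lambda>z. dist (f z) (g x)) \<longlongrightarrow> dist (g y) (g x)) (at y within S)"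
        by (intro tendsto_intros lim y)
      ultimately have "dist (g y) (g x) \<le> e / 2"
        by (intro tendsto_upperbound)
      then show ?thesis using e by simp
    qed (use e in simp)
  qed
qed

lemma islimpt_nonreal: "x islimpt {z. Im z \<noteq> 0}"
  unfolding islimpt_approachable
proof (intro allI impI)
  fix e :: real assume e: "e > 0"
  define \<delta> where "\<delta> = (if Im x < 0 then - e / 2 else e / 2)"
  have "Im (x + of_real \<delta> * \<i>) \<noteq> 0" "\<delta> \<noteq> 0" "\<bar>\<delta>\<bar> < e" using e by (auto simp: \<delta>_def)
  then show "\<exists>x'\<in>{z. Im z \<noteq> 0}. x' \<noteq> x \<and> dist x' x < e"
    by (intro bexI[of _ "x + of_real \<delta> * \<i>"]) (auto simp: dist_norm norm_mult)
qed

lemma tendsto_times_Ln_zero: "((\<lambda>z. z * Ln z) \<longlongrightarrow> 0) (at 0 within S)"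
proof (rule Lim_null_comparison)
  have "\<forall>\<^sub>F z in at 0 within S. z \<in> ball 0 (1::real)"
    by (intro topological_tendstoD[OF tendsto_ident_at]) auto
  then show "\<forall>\<^sub>F z in at 0 within S. norm (z * Ln z) \<le> (2 + pi) * sqrt (norm z)"
  proof eventually_elim
    case (elim z)
    show ?case
    proof (cases "z = 0")
      case False
      then have "norm z * norm (Ln z) \<le> norm z * ((2 + pi) / sqrt (norm z))"
        using elim by (intro mult_left_mono norm_Ln_le) auto
      also have "\<dots> = (2 + pi) * (norm z / sqrt (norm z))" by simp
      also have "norm z / sqrt (norm z) = sqrt (norm z)" by (simp add: real_div_sqrt)
      finally show ?thesis by (simp add: norm_mult)
    qed simp
  qed
  have "((\<lambda>z. (2 + pi) * sqrt (norm z)) \<longlongrightarrow> (2 + pi) * sqrt (norm (0::complex))) (at 0 within S)"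
    by (intro tendsto_intros)
  then show "((\<lambda>z. (2 + pi) * sqrt (norm z)) \<longlongrightarrow> 0) (at 0 within S)"
    by simp
qed

text \<open>
The two jumps cancel: passing from the lower to the upper bank adds \<open>- T * F s\<close> to the first term and
\<open>T / (2 * pi * \<i>) * F s * (2 * pi * \<i>)\<close> to the second. The function is multiplied by \<open>z\<close> in order to
treat the tip as one more point of continuous extension, and divided by \<open>z\<close> again at the end.
\<close>

lemma H_space_expansion_function:
  assumes F: "F \<in> H_space a T" and a: "a > 0"
  obtains h where "h holomorphic_on ball 0 a"
    "\<And>z. norm z < a \<Longrightarrow> z \<notin> \<real>\<^sub>\<le>\<^sub>0 \<Longrightarrow>
       h z = F (z - of_real a) + T / (2 * of_real pi * \<i>) * F (- z) * Ln z"
proof -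
  define c where "c = T / (2 * of_real pi * \<i>)"
  define g where "g z = F (z - of_real a) + c * F (- z) * Ln z" for z
  define k where "k z = z * g z" for z
  let ?S = "{z. Im z \<noteq> 0}"
  have slit: "slit_function a F" by (rule H_space_slit_function[OF F a])
  have hol: "F holomorphic_on cut_plane a" using F by (simp add: H_space_def)
  have cont: "isCont F z" if "z \<in> cut_plane a" for z
    using hol that open_cut_plane holomorphic_on_imp_continuous_on continuous_on_eq_continuous_at by blast
  have in1: "z - of_real a \<in> cut_plane a" if "z \<notin> \<real>\<^sub>\<le>\<^sub>0" for z
  proof -
    have False if "z - of_real a = of_real x" "x \<le> - a" for x :: real
    proof -
      have "z = of_real (x + a)" using that by (simp add: algebra_simps)
      then show False using \<open>z \<notin> \<real>\<^sub>\<le>\<^sub>0\<close> that by (simp only: nonpos_Reals_of_real_iff)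
    qed
    then show ?thesis by (auto simp: cut_plane_def)
  qed
  have in2: "z \<in> cut_plane a" if "norm z < a" for z
    using that a by (auto simp: cut_plane_def)
  define U :: "complex set" where "U = ball 0 a - \<real>\<^sub>\<le>\<^sub>0"
  have U: "open U" unfolding U_def by (intro open_Diff closed_nonpos_Reals_complex) auto
  have ghol: "g holomorphic_on U"
  proof -
    have "(F \<circ> (\<lambda>z. z - of_real a)) holomorphic_on U" "(F \<circ> (\<lambda>z. - z)) holomorphic_on U"
      by (rule holomorphic_on_compose_gen[OF _ hol]; use in1 in2 in \<open>auto intro!: holomorphic_intros simp: U_def\<close>)+
    then show ?thesis unfolding g_def by (auto intro!: holomorphic_intros simp: o_def U_def)
  qed
  have khol: "k holomorphic_on U" unfolding k_def by (intro holomorphic_intros ghol)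
  have lim_U: "(k \<longlongrightarrow> k x) (at x within ?S)" if "x \<in> U" for x
  proof -
    have "isCont k x"
      using khol U that holomorphic_on_imp_continuous_on continuous_on_eq_continuous_at by blast
    then show ?thesis unfolding isCont_def by (rule tendsto_within_subset) auto
  qed
  have lim_0: "(k \<longlongrightarrow> 0) (at 0 within ?S)"
  proof -
    obtain C where C: "\<And>t. t \<in> cut_plane a \<Longrightarrow>
        norm (F t) \<le> C * (1 + 1 / sqrt (norm (t + of_real a))) * exp (1 * norm t)"
      using slit zero_less_one unfolding slit_function_def by blast
    have 1: "((\<lambda>z. z * F (z - of_real a)) \<longlongrightarrow> 0) (at 0 within ?S)"
    proof (rule Lim_null_comparison)
      show "\<forall>\<^sub>F z in at 0 within ?S. norm (z * F (z - of_real a)) \<le>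
          C * (norm z + sqrt (norm z)) * exp (norm (z - of_real a))"
        unfolding eventually_at_filter
      proof (intro always_eventually allI impI)
        fix z :: complex assume z: "z \<noteq> 0" "z \<in> ?S"
        then have "z - of_real a \<in> cut_plane a" by (intro in1) (auto elim!: nonpos_Reals_cases)
        then have "norm z * norm (F (z - of_real a)) \<le>
            norm z * (C * (1 + 1 / sqrt (norm z)) * exp (norm (z - of_real a)))"
          using C[of "z - of_real a"] by (intro mult_left_mono) auto
        also have "\<dots> = C * (norm z + norm z / sqrt (norm z)) * exp (norm (z - of_real a))"
          by (simp add: algebra_simps)
        also have "norm z / sqrt (norm z) = sqrt (norm z)"
          by (simp add: real_div_sqrt)
        finally show "norm (z * F (z - of_real a)) \<le>
          C * (norm z + sqrt (norm z)) * exp (norm (z - of_real a))" by (simp add: norm_mult)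
      qed
      have "((\<lambda>z. C * (norm z + sqrt (norm z)) * exp (norm (z - of_real a))) \<longlongrightarrow>
          C * (norm (0::complex) + sqrt (norm (0::complex))) * exp (norm (0 - of_real a :: complex))) (at 0 within ?S)"
        by (intro tendsto_intros)
      then show "((\<lambda>z. C * (norm z + sqrt (norm z)) * exp (norm (z - of_real a))) \<longlongrightarrow> 0) (at 0 within ?S)"
        by simp
    qed
    note 2 = tendsto_times_Ln_zero[of ?S]
    have 3: "((\<lambda>z. F (- z)) \<longlongrightarrow> F (- 0)) (at 0 within ?S)"
      using cont[OF in2[of 0]] a by (intro isCont_tendsto_compose[of _ F] tendsto_intros) auto
    have "((\<lambda>z. z * F (z - of_real a) + c * F (- z) * (z * Ln z)) \<longlongrightarrow> 0 + c * F (- 0) * 0) (at 0 within ?S)"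
      by (intro tendsto_intros 1 2 3)
    moreover have "k = (\<lambda>z. z * F (z - of_real a) + c * F (- z) * (z * Ln z))"
      by (auto simp: fun_eq_iff k_def g_def algebra_simps)
    ultimately show ?thesis by simp
  qed
  have lim_neg: "\<exists>L. (k \<longlongrightarrow> L) (at (- of_real s) within ?S)" if s: "0 < s" "s < a" for s
  proof -
    let ?x = "- of_real s :: complex"
    obtain u l where ul: "(F \<longlongrightarrow> u) (at (- of_real (a + s)) within {t. Im t > 0})"
        "(F \<longlongrightarrow> l) (at (- of_real (a + s)) within {t. Im t < 0})" "u = l - T * F (of_real s)"
      using F s unfolding H_space_def by blast
    have shift: "filterlim (\<lambda>z. z - of_real a) (at (- of_real (a + s)) within A) (at ?x within A)"
      if "\<And>z. z \<in> A \<Longrightarrow> z - of_real a \<in> A" for A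
      unfolding filterlim_at
      using that by (auto simp: eventually_at_filter intro!: tendsto_eq_intros always_eventually)
    have c: "c * (2 * of_real pi * \<i>) = T" by (simp add: c_def)
    have Fs: "((\<lambda>z. F (- z)) \<longlongrightarrow> F (- ?x)) (at ?x within A)" for A
      using s by (intro isCont_tendsto_compose[OF cont] tendsto_intros in2) auto
    have Lns: "((\<lambda>z. Ln (- z)) \<longlongrightarrow> Ln (- ?x)) (at ?x within A)" for A
      using s by (intro tendsto_intros) (auto simp: complex_nonpos_Reals_iff)
    have up: "((\<lambda>z. z * (F (z - of_real a) + c * F (- z) * (Ln (- z) + of_real pi * \<i>))) \<longlongrightarrow>
        ?x * (u + c * F (- ?x) * (Ln (- ?x) + of_real pi * \<i>))) (at ?x within {z. Im z > 0})"
      by (intro tendsto_intros Fs Lns filterlim_compose[OF ul(1) shift]) auto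
    have lo: "((\<lambda>z. z * (F (z - of_real a) + c * F (- z) * (Ln (- z) - of_real pi * \<i>))) \<longlongrightarrow>
        ?x * (l + c * F (- ?x) * (Ln (- ?x) - of_real pi * \<i>))) (at ?x within {z. Im z < 0})"
      by (intro tendsto_intros Fs Lns filterlim_compose[OF ul(2) shift]) auto
    have eq: "u + c * F (- ?x) * (Ln (- ?x) + of_real pi * \<i>) =
        l + c * F (- ?x) * (Ln (- ?x) - of_real pi * \<i>)"
    proof -
      have "u = l - c * (2 * of_real pi * \<i>) * F (- ?x)" using ul(3) c by simp
      then show ?thesis by (simp add: algebra_simps)
    qed
    have up': "(k \<longlongrightarrow> ?x * (u + c * F (- ?x) * (Ln (- ?x) + of_real pi * \<i>))) (at ?x within {z. Im z > 0})"
      by (rule Lim_transform_eventually[OF up])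
        (auto simp: eventually_at_filter k_def g_def Ln_minus intro!: always_eventually)
    have lo': "(k \<longlongrightarrow> ?x * (u + c * F (- ?x) * (Ln (- ?x) + of_real pi * \<i>))) (at ?x within {z. Im z < 0})"
      unfolding eq
      by (rule Lim_transform_eventually[OF lo])
        (auto simp: eventually_at_filter k_def g_def Ln_minus intro!: always_eventually)
    have "?S = {z. Im z > 0} \<union> {z. Im z < 0}" by auto
    then show ?thesis using up' lo' by (metis Lim_within_Un)
  qed
  have "\<exists>L. (k \<longlongrightarrow> L) (at x within ?S)" if "x \<in> ball 0 a" for x
  proof -
    consider "x \<in> U" | "x = 0" | s where "x = - of_real s" "0 < s" "s < a"
    proof (cases "x \<in> \<real>\<^sub>\<le>\<^sub>0")
      case True
      then obtain r where r: "x = of_real r" "r \<le> 0" by (auto elim!: nonpos_Reals_cases)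
      then show thesis
        using that(2) that(3)[of "- r"] \<open>x \<in> ball 0 a\<close> by (cases "r = 0") auto
    next
      case False
      then show thesis using that(1) \<open>x \<in> ball 0 a\<close> by (auto simp: U_def)
    qed
    then show ?thesis using lim_U lim_0 lim_neg by cases blast+
  qed
  then obtain H where H: "\<And>x. x \<in> ball 0 a \<Longrightarrow> (k \<longlongrightarrow> H x) (at x within ?S)" by metis
  have nt: "at x within ?S \<noteq> bot" for x using islimpt_nonreal by (simp add: trivial_limit_within)
  have HU: "H x = k x" if "x \<in> U" for x
    using tendsto_unique[OF nt H lim_U] that by (simp add: U_def)
  have H0: "H 0 = 0" using tendsto_unique[OF nt H lim_0] a by simp
  have Hhol: "H holomorphic_on ball 0 a \<inter> A" if "A \<subseteq> ?S" for A
  proof (rule holomorphic_transform)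
    have sub: "ball 0 a \<inter> A \<subseteq> U" using that by (auto simp: U_def elim!: nonpos_Reals_cases)
    then show "k holomorphic_on ball 0 a \<inter> A" using khol holomorphic_on_subset by blast
    show "k x = H x" if "x \<in> ball 0 a \<inter> A" for x using HU sub that by auto
  qed
  have "H holomorphic_on ball 0 a"
  proof (rule holomorphic_on_paste_across_line[of _ \<i> _ 0])
    show "continuous_on (ball 0 a) H"
      by (rule continuous_on_limits[OF H]) (auto intro: islimpt_nonreal)
  qed (auto intro!: Hhol simp: inner_complex_def)
  then have "(\<lambda>z. if z = 0 then deriv H 0 else (H z - H 0) / (z - 0)) holomorphic_on ball 0 a"
    using a by (intro pole_lemma) (auto simp: interior_open)
  moreover have "(H z - H 0) / (z - 0) = g z" "z \<noteq> 0" if "norm z < a" "z \<notin> \<real>\<^sub>\<le>\<^sub>0" for z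
  proof -
    show "z \<noteq> 0" using that by auto
    then show "(H z - H 0) / (z - 0) = g z" using that HU[of z] H0 by (simp add: U_def k_def)
  qed
  ultimately show thesis
    by (intro that[of "\<lambda>z. if z = 0 then deriv H 0 else (H z - H 0) / (z - 0)"]) (auto simp: g_def c_def)
qed

section \<open>A primitive for the inversion integral\<close>

lemma slit_function_const: "slit_function a (\<lambda>_. c)"
  unfolding slit_function_def
proof (intro conjI allI impI)
  fix \<epsilon> :: real assume \<epsilon>: "\<epsilon> > 0"
  have "norm c \<le> norm c * (1 + 1 / sqrt (norm (t + of_real a))) * exp (\<epsilon> * norm t)" for t :: complex
  proof -
    have "norm c * 1 * 1 \<le> norm c * (1 + 1 / sqrt (norm (t + of_real a))) * exp (\<epsilon> * norm t)"
      using \<epsilon> by (intro mult_mono) auto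
    then show ?thesis by simp
  qed
  then show "\<exists>C. \<forall>t\<in>cut_plane a. norm c \<le> C * (1 + 1 / sqrt (norm (t + of_real a))) * exp (\<epsilon> * norm t)"
    by blast
qed auto

lemma set_integral_exp_minus:
  fixes c :: real
  assumes "c > 0"
  shows "(LBINT s:{b..}. exp (- c * s)) = exp (- c * b) / c"
  using set_borel_integral_eq_integral(2)[OF set_integrable_exp_minus[OF assms]]
    has_integral_exp_minus_to_infinity[OF assms, of b] by (simp add: integral_unique)

lemma ray_laplace_const:
  fixes a :: real
  assumes "a > 0" "\<bar>Im w\<bar> < pi" "\<bar>Im \<eta>\<bar> < pi / 2" "\<bar>Im (\<eta> - w)\<bar> < pi"
  shows "ray_laplace (\<lambda>_. c) \<eta> w = c"
proof -
  have "ray_laplace (\<lambda>_. c) \<eta> w = ray_laplace (\<lambda>_. c) 0 w"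
    using assms by (intro ray_laplace_rotate[OF slit_function_const, of a])
  also have "\<dots> = (LBINT s:{0..}. complex_of_real (exp (- 1 * s)) * c)"
    by (simp add: ray_laplace_def exp_of_real[symmetric])
  also have "\<dots> = complex_of_real (LBINT s:{0..}. exp (- 1 * s)) * c"
    by (simp only: set_integral_mult_left set_integral_complex_of_real)
  also have "\<dots> = c" using set_integral_exp_minus[of 1 0] by simp
  finally show ?thesis .
qed

text \<open>
The transform of a constant is that constant, so subtracting it from \<open>f\<close> subtracts it from the transform.
\<close>

lemma ray_laplace_minus_const:
  fixes c :: complex
  assumes f: "slit_function a f" "a > 0"
    and w: "\<bar>Im w\<bar> < pi" and \<eta>: "\<bar>Im \<eta>\<bar> < pi / 2" "\<bar>Im (\<eta> - w)\<bar> < pi"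
  defines "J \<equiv> \<lambda>s::real. exp (- (of_real s * exp \<eta>)) * (f (of_real s * exp (\<eta> - w)) - c) * exp \<eta>"
  shows "set_integrable lborel {0..} J"
    and "(LBINT s:{0..}. J s) = ray_laplace f 0 w - c"
proof -
  have a1: "set_integrable lborel {0..} (\<lambda>s. exp (- (of_real s * exp \<eta>)) * f (of_real s * exp (\<eta> - w)) * exp \<eta>)"
    by (rule ray_integrand_integrable[OF f \<eta>])
  have a2: "set_integrable lborel {0..} (\<lambda>s. exp (- (of_real s * exp \<eta>)) * c * exp \<eta>)"
    by (rule ray_integrand_integrable[OF slit_function_const[of a c] f(2) \<eta>])
  have J: "J = (\<lambda>s. exp (- (of_real s * exp \<eta>)) * f (of_real s * exp (\<eta> - w)) * exp \<eta>
      - exp (- (of_real s * exp \<eta>)) * c * exp \<eta>)"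
    by (auto simp: J_def algebra_simps)
  show "set_integrable lborel {0..} J" unfolding J by (rule set_integral_diff(1)[OF a1 a2])
  have "(LBINT s:{0..}. J s) = ray_laplace f \<eta> w - ray_laplace (\<lambda>_. c) \<eta> w"
    unfolding J ray_laplace_def by (rule set_integral_diff(2)[OF a1 a2])
  then show "(LBINT s:{0..}. J s) = ray_laplace f 0 w - c"
    using ray_laplace_rotate[OF f w \<eta>] ray_laplace_const[OF f(2) w \<eta>] by simp
qed

text \<open>
This replaces an exchange of integrals and a residue computation. For \<open>\<zeta> = exp w\<close> the
function on the left is \<open>exp (t * \<zeta>) * \<integral> exp (- \<zeta> * s) * D s ds\<close>. Its \<open>\<zeta>\<close>-derivative brings down a
factor \<open>t - s\<close>, which cancels the denominator of \<open>D\<close> and leaves \<open>F t - F s\<close>.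
\<close>

lemma divided_difference_laplace_has_field_derivative:
  assumes f: "slit_function a f" "a > 0" and t: "t \<in> cut_plane a" and w: "\<bar>Im w\<bar> < pi"
  defines "D \<equiv> \<lambda>s. if s = t then deriv f t else (f s - f t) / (s - t)"
  shows "((\<lambda>w. exp (t * exp w) * exp (- w) * ray_laplace D 0 w) has_field_derivative
           - (exp (t * exp w) * (ray_laplace f 0 w - f t))) (at w)"
proof -
  have D: "slit_function a D"
    unfolding D_def by (rule slit_function_divided_difference[OF f(1) t])
  have Dt: "(s - t) * D s = f s - f t" for s by (simp add: D_def)
  \<comment> \<open>The ray \<open>x + c\<close> makes the argument of \<open>D\<close> independent of \<open>x\<close>, and \<open>\<eta>\<close> is real at the point \<open>w\<close>.\<close>
  define c where "c = - \<i> * of_real (Im w)"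
  define \<eta> where "\<eta> = w + c"
  have c: "\<bar>Im c\<bar> < pi" "Im \<eta> = 0" using w by (auto simp: c_def \<eta>_def)
  have conds: "\<bar>Im \<eta>\<bar> < pi / 2" "\<bar>Im (\<eta> - w)\<bar> < pi" using c by (simp_all add: \<eta>_def)
  define I where "I s = exp (- (of_real s * exp \<eta>)) * D (of_real s * exp c) * exp \<eta>" for s :: real
  define I' where "I' s = (1 - of_real s * exp \<eta>) * I s" for s :: real
  have dI: "deriv (\<lambda>x. exp (- (of_real s * exp (x + c))) * D (of_real s * exp (x + c - x)) * exp (x + c)) w = I' s" for s
    by (rule DERIV_imp_deriv) (auto intro!: derivative_eq_intros simp: I'_def I_def \<eta>_def algebra_simps)
  have "((\<lambda>x. ray_laplace D (x + c) x) has_field_derivative (LBINT s:{0..}. I' s)) (at w)"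
  proof -
    have "(\<lambda>x. x + c) holomorphic_on UNIV" "(\<lambda>x. x) holomorphic_on UNIV"
      by (intro holomorphic_intros)+
    from ray_laplace_has_field_derivative[OF D f(2) this, of w] show ?thesis
      using c unfolding dI by (simp add: \<eta>_def)
  qed
  moreover have "\<forall>\<^sub>F x in nhds w. ray_laplace D (x + c) x = ray_laplace D 0 x"
  proof -
    have "\<forall>\<^sub>F x in nhds w. x \<in> ball w (min (pi / 2) (pi - \<bar>Im w\<bar>))"
      using w by (intro eventually_nhds_in_open) auto
    then show ?thesis
    proof eventually_elim
      case (elim x)
      have "\<bar>Im (x - w)\<bar> < min (pi / 2) (pi - \<bar>Im w\<bar>)"
        using elim abs_Im_le_cmod[of "x - w"] by (simp add: dist_norm norm_minus_commute)
      then have "\<bar>Im x - Im w\<bar> < pi / 2" "\<bar>Im x - Im w\<bar> < pi - \<bar>Im w\<bar>" by auto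
      then show ?case using c
        by (intro ray_laplace_rotate[OF D f(2)]) (auto simp: c_def)
    qed
  qed
  ultimately have der: "((\<lambda>x. ray_laplace D 0 x) has_field_derivative (LBINT s:{0..}. I' s)) (at w)"
    by (subst (asm) DERIV_cong_ev[OF refl _ refl]) auto
  have LD: "ray_laplace D 0 w = (LBINT s:{0..}. I s)"
    using ray_laplace_rotate[OF D f(2) w, of \<eta>] conds
    unfolding ray_laplace_def I_def \<eta>_def by (simp add: \<eta>_def)
  define J where "J s = exp (- (of_real s * exp \<eta>)) * (f (of_real s * exp c) - f t) * exp \<eta>" for s :: real
  have i1: "set_integrable lborel {0..} I"
    using ray_integrand_integrable[OF D f(2) conds] unfolding I_def \<eta>_def by simp
  have i2: "set_integrable lborel {0..} J"
    and LJ: "(LBINT s:{0..}. J s) = ray_laplace f 0 w - f t"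
    using ray_laplace_minus_const[OF f w conds, of "f t"] by (simp_all add: J_def[abs_def] \<eta>_def)
  have J_eq: "I' s = (1 - t * exp w) * I s - exp w * J s" for s
  proof -
    have e: "exp \<eta> = exp w * exp c" by (simp add: \<eta>_def exp_add)
    have "J s = exp (- (of_real s * exp \<eta>)) * ((of_real s * exp c - t) * D (of_real s * exp c)) * exp \<eta>"
      by (simp only: J_def Dt)
    then have Js: "J s = (of_real s * exp c - t) * I s" by (simp add: I_def mult_ac)
    have "I' s = (1 - exp w * (of_real s * exp c)) * I s" by (simp add: I'_def e mult_ac)
    then show ?thesis unfolding Js by (simp only:) (simp add: algebra_simps)
  qed
  have LI': "(LBINT s:{0..}. I' s) = (1 - t * exp w) * (LBINT s:{0..}. I s) - exp w * (LBINT s:{0..}. J s)"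
    unfolding J_eq using i1 i2 by (subst set_integral_diff(2)) auto
  show ?thesis
  proof (rule DERIV_cong)
    show "((\<lambda>w. exp (t * exp w) * exp (- w) * ray_laplace D 0 w) has_field_derivative
      (exp (t * exp w) * (t * exp w) * exp (- w) + exp (t * exp w) * - exp (- w)) * ray_laplace D 0 w
      + (exp (t * exp w) * exp (- w)) * (LBINT s:{0..}. I' s)) (at w)"
    proof -
      have "((\<lambda>w. exp (t * exp w) * exp (- w)) has_field_derivative
        (exp (t * exp w) * (t * exp w) * exp (- w) + exp (t * exp w) * - exp (- w))) (at w)"
        by (auto intro!: derivative_eq_intros simp: algebra_simps)
      from DERIV_mult[OF this der] show ?thesis by (simp add: mult.commute)
    qed
    have "exp (- w) * exp w = 1" by (simp add: exp_minus)
    then show "(exp (t * exp w) * (t * exp w) * exp (- w) + exp (t * exp w) * - exp (- w)) * ray_laplace D 0 w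
      + (exp (t * exp w) * exp (- w)) * (LBINT s:{0..}. I' s) = - (exp (t * exp w) * (ray_laplace f 0 w - f t))"
      unfolding LI' LJ LD by algebra
  qed
qed

section \<open>Boundary values on the banks of the cut\<close>

lemma set_integrable_inverse_sqrt_kernel:
  fixes a c :: real
  assumes c: "c > 0"
  shows "set_integrable lborel {0..} (\<lambda>s. (1 + 1 / sqrt \<bar>s - a\<bar>) * exp (- c * s))"
proof -
  \<comment> \<open>\<open>g (s - a)\<close> and \<open>g (a - s)\<close> are the two halves of the singularity at \<open>a\<close>, cut off at distance \<open>1\<close>.\<close>
  define g where "g x = indicator {0..1} x * (1 / sqrt x)" for x :: real
  have "set_integrable lborel {0..1} (\<lambda>x::real. x powr (- 1 / 2))"
    using has_integral_powr_from_0[of "- 1 / 2" 1]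
    by (intro set_integrable_lborel_nonneg) (auto simp: integrable_on_def)
  then have g: "integrable lborel g"
    unfolding set_integrable_def
    by (rule Bochner_Integration.integrable_cong[THEN iffD1, rotated -1])
      (auto simp: g_def indicator_def powr_minus powr_half_sqrt divide_simps)
  have g1: "integrable lborel (\<lambda>s. g (s - a))"
    using lborel_integrable_real_affine[OF g, of 1 "- a"] by (simp add: algebra_simps)
  have g2: "integrable lborel (\<lambda>s. g (a - s))"
    using lborel_integrable_real_affine[OF g, of "- 1" a] by simp
  have e: "integrable lborel (\<lambda>s. indicator {0..} s * exp (- c * s))"
    using set_integrable_exp_minus[OF c] by (simp add: set_integrable_def)
  have "integrable lborel (\<lambda>s. 2 * (indicator {0..} s * exp (- c * s)) + g (s - a) + g (a - s))"
    using g1 g2 e by (intro Bochner_Integration.integrable_add integrable_mult_right)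
  then show ?thesis unfolding set_integrable_def
  proof (rule Bochner_Integration.integrable_bound)
    show "AE s in lborel. norm (indicator {0..} s *\<^sub>R ((1 + 1 / sqrt \<bar>s - a\<bar>) * exp (- c * s))) \<le>
        norm (2 * (indicator {0..} s * exp (- c * s)) + g (s - a) + g (a - s))"
    proof (rule AE_I2)
      fix s :: real
      have gn: "g x \<ge> 0" for x by (simp add: g_def indicator_def)
      show "norm (indicator {0..} s *\<^sub>R ((1 + 1 / sqrt \<bar>s - a\<bar>) * exp (- c * s))) \<le>
        norm (2 * (indicator {0..} s * exp (- c * s)) + g (s - a) + g (a - s))"
      proof (cases "s \<ge> 0")
        case True
        have e1: "exp (- c * s) \<le> 1" using True c by simp
        have "1 / sqrt \<bar>s - a\<bar> * exp (- c * s) \<le> exp (- c * s) + (g (s - a) + g (a - s))"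
        proof (cases "\<bar>s - a\<bar> \<le> 1")
          case near: True
          have "1 / sqrt \<bar>s - a\<bar> \<le> g (s - a) + g (a - s)"
            using near by (cases "s \<ge> a") (auto simp: g_def indicator_def)
          moreover have "1 / sqrt \<bar>s - a\<bar> * exp (- c * s) \<le> 1 / sqrt \<bar>s - a\<bar>"
            using e1 by (simp add: divide_right_mono)
          ultimately show ?thesis using exp_ge_zero[of "- c * s"] by linarith
        next
          case False
          then have "1 / sqrt \<bar>s - a\<bar> \<le> 1" by (simp add: divide_le_eq_1)
          then have "1 / sqrt \<bar>s - a\<bar> * exp (- c * s) \<le> 1 * exp (- c * s)"
            by (intro mult_right_mono) auto
          then show ?thesis using gn[of "s - a"] gn[of "a - s"] by linarith
        qed
        then show ?thesis using True gn[of "s - a"] gn[of "a - s"]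
          by (simp add: distrib_right)
      qed auto
    qed
  qed auto
qed

text \<open>
For \<open>w = ln r + \<kappa> * \<phi> * \<i>\<close> the transform integrates \<open>f\<close> over the ray of argument \<open>- \<kappa> * \<phi>\<close>, which
tends to the lower bank of the cut for \<open>\<kappa> = 1\<close> and to the upper bank for \<open>\<kappa> = -1\<close>. On the circle of
radius \<open>s\<close> the distance to the tip is at least \<open>\<bar>s - a\<bar>\<close>, so the growth condition gives one
integrable bound for all \<open>\<phi>\<close>. The radius \<open>s = a\<close>, which meets the tip in the limit, is left out.
\<close>

lemma ray_laplace_bank_limit:
  assumes f: "slit_function a f" "a > 0" and r: "r > 0" and \<kappa>: "\<kappa> = 1 \<or> \<kappa> = - 1"
    and L: "\<And>s. s > 0 \<Longrightarrow> (f \<longlongrightarrow> L s) (at (- of_real (a + s)) within {t. \<kappa> * Im t < 0})"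
  defines "B \<equiv> \<lambda>s. of_real (exp (- r * s)) * (if s < a then f (- of_real s) else L (s - a))"
  shows "set_integrable lborel ({0..} - {a}) B"
    and "((\<lambda>\<phi>. ray_laplace f 0 (of_real (ln r) + of_real (\<kappa> * \<phi>) * \<i>)) \<longlongrightarrow>
           of_real r * (LBINT s:{0..} - {a}. B s)) (at_left pi)"
proof -
  let ?A = "{0..} - {a}"
  let ?p = "\<lambda>\<phi> s. of_real s * exp (- (of_real (\<kappa> * \<phi>) * \<i>)) :: complex"
  obtain C where C: "\<And>t. t \<in> cut_plane a \<Longrightarrow>
      norm (f t) \<le> C * (1 + 1 / sqrt (norm (t + of_real a))) * exp (r / 2 * norm t)"
    using f r half_gt_zero unfolding slit_function_def by blast
  have pe: "?p \<phi> s = of_real (s * cos \<phi>) - of_real (\<kappa> * s * sin \<phi>) * \<i>" for \<phi> s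
    using \<kappa> by (auto simp: complex_eq_iff Re_exp Im_exp)
  have near: "\<forall>\<^sub>F \<phi> in at_left pi. 0 < \<phi> \<and> \<phi> < pi"
    using eventually_at_left_real[of 0 pi] by auto
  have inplane: "?p \<phi> s \<in> cut_plane a" if "0 < \<phi>" "\<phi> < pi" "s \<ge> 0" for \<phi> s
    using \<kappa> f that by (intro ray_in_cut_plane) auto
  have tp: "((\<lambda>\<phi>. ?p \<phi> s) \<longlongrightarrow> - of_real s) (at_left pi)" for s
  proof -
    have "((\<lambda>\<phi>. of_real (s * cos \<phi>) - of_real (\<kappa> * s * sin \<phi>) * \<i>) \<longlongrightarrow>
        of_real (s * cos pi) - of_real (\<kappa> * s * sin pi) * \<i>) (at_left pi)"
      by (intro tendsto_intros)
    then show ?thesis unfolding pe by simp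
  qed
  have lim: "((\<lambda>\<phi>. of_real (exp (- r * s)) * f (?p \<phi> s)) \<longlongrightarrow> B s) (at_left pi)" if s: "s \<in> ?A" for s
  proof -
    have "((\<lambda>\<phi>. f (?p \<phi> s)) \<longlongrightarrow> (if s < a then f (- of_real s) else L (s - a))) (at_left pi)"
    proof (cases "s < a")
      case True
      then have "- of_real s \<in> cut_plane a" using s by (auto simp: cut_plane_def)
      then have "isCont f (- of_real s)"
        using slit_function_continuous_on[OF f(1)] open_cut_plane continuous_on_eq_continuous_at by blast
      then show ?thesis using isCont_tendsto_compose[OF _ tp] True by simp
    next
      case False
      then have sa: "s - a > 0" using s by auto
      have "filterlim (\<lambda>\<phi>. ?p \<phi> s) (at (- of_real (a + (s - a))) within {t. \<kappa> * Im t < 0}) (at_left pi)"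
        unfolding filterlim_at
      proof (intro conjI)
        show "\<forall>\<^sub>F \<phi> in at_left pi. ?p \<phi> s \<in> {t. \<kappa> * Im t < 0} \<and> ?p \<phi> s \<noteq> - of_real (a + (s - a))"
          using near
        proof eventually_elim
          case (elim \<phi>)
          have "s * sin \<phi> > 0" using sa f elim by (intro mult_pos_pos sin_gt_zero) auto
          then have neg: "\<kappa> * Im (?p \<phi> s) < 0" unfolding pe using \<kappa> by auto
          have "?p \<phi> s \<noteq> - of_real (a + (s - a))"
          proof
            assume "?p \<phi> s = - of_real (a + (s - a))"
            then have "Im (?p \<phi> s) = Im (- of_real (a + (s - a)))" by (rule arg_cong)
            then have "Im (?p \<phi> s) = 0" by (simp only: uminus_complex.sel Im_complex_of_real minus_zero)
            then have "\<kappa> * Im (?p \<phi> s) = 0" by (simp only: mult_zero_right)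
            then show False using neg by (simp only: less_irrefl)
          qed
          then show ?case using neg by (intro conjI CollectI)
        qed
      qed (use tp in simp)
      then show ?thesis using filterlim_compose[OF L[OF sa]] False by simp
    qed
    then show ?thesis unfolding B_def by (intro tendsto_intros)
  qed
  have ev: "\<forall>\<^sub>F \<phi> in at_left pi. set_borel_measurable lborel ?A (\<lambda>s. of_real (exp (- r * s)) * f (?p \<phi> s)) \<and>
      (\<forall>s\<in>?A. norm (of_real (exp (- r * s)) * f (?p \<phi> s)) \<le> \<bar>C\<bar> * ((1 + 1 / sqrt \<bar>s - a\<bar>) * exp (- (r / 2) * s)))"
    using near
  proof eventually_elim
    case (elim \<phi>)
    have "continuous_on ?A (\<lambda>s. f (?p \<phi> s))"
      by (rule continuous_on_compose2[OF slit_function_continuous_on[OF f(1)]])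
        (use elim inplane in \<open>auto intro!: continuous_intros\<close>)
    then have "set_borel_measurable lborel ?A (\<lambda>s. of_real (exp (- r * s)) * f (?p \<phi> s))"
      unfolding set_borel_measurable_def measurable_lborel2
      by (intro borel_measurable_continuous_on_indicator continuous_intros) auto
    moreover have "norm (of_real (exp (- r * s)) * f (?p \<phi> s)) \<le>
        \<bar>C\<bar> * ((1 + 1 / sqrt \<bar>s - a\<bar>) * exp (- (r / 2) * s))" if s: "s \<in> ?A" for s
    proof -
      have n: "norm (?p \<phi> s) = s" using s by (simp add: norm_mult)
      have "\<bar>s - a\<bar> \<le> norm (?p \<phi> s + of_real a)"
        using norm_triangle_ineq3[of "?p \<phi> s" "- of_real a"] n f by simp
      moreover have "\<bar>s - a\<bar> > 0" using s by auto
      ultimately have q: "1 / sqrt (norm (?p \<phi> s + of_real a)) \<le> 1 / sqrt \<bar>s - a\<bar>"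
        by (intro divide_left_mono real_sqrt_le_mono mult_pos_pos) auto
      have "norm (f (?p \<phi> s)) \<le> C * (1 + 1 / sqrt (norm (?p \<phi> s + of_real a))) * exp (r / 2 * s)"
        using C[OF inplane[of \<phi> s]] elim s n by auto
      also have "\<dots> \<le> \<bar>C\<bar> * (1 + 1 / sqrt \<bar>s - a\<bar>) * exp (r / 2 * s)"
        using q by (intro mult_mono mult_nonneg_nonneg add_mono) auto
      finally have "exp (- r * s) * norm (f (?p \<phi> s)) \<le>
          exp (- r * s) * (\<bar>C\<bar> * (1 + 1 / sqrt \<bar>s - a\<bar>) * exp (r / 2 * s))"
        by (intro mult_left_mono) auto
      also have "\<dots> = \<bar>C\<bar> * ((1 + 1 / sqrt \<bar>s - a\<bar>) * (exp (- r * s) * exp (r / 2 * s)))" by simp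
      also have "exp (- r * s) * exp (r / 2 * s) = exp (- (r / 2) * s)"
        by (simp add: exp_add[symmetric])
      finally show ?thesis by (simp add: norm_mult)
    qed
    ultimately show ?case by blast
  qed
  have G: "set_integrable lborel ?A (\<lambda>s. \<bar>C\<bar> * ((1 + 1 / sqrt \<bar>s - a\<bar>) * exp (- (r / 2) * s)))"
    using set_integrable_inverse_sqrt_kernel[of "r / 2" a] r
    by (intro set_integrable_mult_right) (auto intro: set_integrable_subset)
  note dom = set_dominated_convergence_within[OF _ _ ev G lim]
  show "set_integrable lborel ?A B" by (rule dom(1)) auto
  have "((\<lambda>\<phi>. of_real r * (LBINT s:?A. of_real (exp (- r * s)) * f (?p \<phi> s))) \<longlongrightarrow>
      of_real r * (LBINT s:?A. B s)) (at_left pi)"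
    by (intro tendsto_intros dom(2)) auto
  moreover have "\<forall>\<^sub>F \<phi> in at_left pi. of_real r * (LBINT s:?A. of_real (exp (- r * s)) * f (?p \<phi> s)) =
      ray_laplace f 0 (of_real (ln r) + of_real (\<kappa> * \<phi>) * \<i>)"
  proof (rule always_eventually, rule allI)
    fix \<phi> :: real
    let ?w = "of_real (ln r) + of_real (\<kappa> * \<phi>) * \<i> :: complex"
    have er: "exp (of_real (ln r)) = complex_of_real r" using r by (metis exp_ln exp_of_real)
    have "ray_laplace f 0 ?w = ray_laplace f (of_real (ln r)) ?w"
      by (rule ray_laplace_real_shift[symmetric]) simp
    also have "\<dots> = (LBINT s:{0..}. of_real (exp (- r * s)) * f (?p \<phi> s) * of_real r)"
      unfolding ray_laplace_def er
      by (intro set_lebesgue_integral_cong) (auto simp: exp_of_real[symmetric] mult.commute)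
    also have "\<dots> = (LBINT s:?A. of_real (exp (- r * s)) * f (?p \<phi> s) * of_real r)"
      by (rule set_integral_discrete_difference[of "{a}"]) auto
    finally show "of_real r * (LBINT s:?A. of_real (exp (- r * s)) * f (?p \<phi> s)) = ray_laplace f 0 ?w"
      by simp
  qed
  ultimately show "((\<lambda>\<phi>. ray_laplace f 0 (of_real (ln r) + of_real (\<kappa> * \<phi>) * \<i>)) \<longlongrightarrow>
           of_real r * (LBINT s:?A. B s)) (at_left pi)"
    by (rule Lim_transform_eventually)
qed

section \<open>The inversion formula\<close>

text \<open>
Cauchy's formula for \<open>exp (- c * u)\<close> at the centre of the unit circle, turned by half a revolution.
\<close>

lemma has_integral_exp_cis:
  "((\<lambda>\<phi>. exp (c * cis \<phi>)) has_integral of_real (2 * pi)) {- pi..pi}"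
proof -
  have "((\<lambda>u. exp (- c * u) / (u - 0)) has_contour_integral 2 * of_real pi * \<i> * exp (- c * 0)) (circlepath 0 1)"
    by (rule Cauchy_integral_circlepath_simple) (auto intro!: holomorphic_intros)
  then have "((\<lambda>\<phi>. exp (- c * (0 + of_real 1 * cis \<phi>)) / (0 + of_real 1 * cis \<phi> - 0) * of_real 1 * \<i> * cis \<phi>)
      has_integral 2 * of_real pi * \<i> * exp (- c * 0)) {0..2 * pi}"
    unfolding circlepath_def by (subst (asm) has_contour_integral_part_circlepath_iff) auto
  then have "((\<lambda>\<phi>. \<i> * exp (- (c * cis \<phi>))) has_integral 2 * of_real pi * \<i>) {- pi + pi..pi + pi}"
    by (simp add: mult.commute)
  then have "(((\<lambda>\<phi>. \<i> * exp (- (c * cis \<phi>))) \<circ> ((+) pi)) has_integral 2 * of_real pi * \<i>) {- pi..pi}"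
    by (simp only: has_integral_shift_Icc_real)
  then have "((\<lambda>\<phi>. - \<i> * (\<i> * exp (c * cis \<phi>))) has_integral - \<i> * (2 * of_real pi * \<i>)) {- pi..pi}"
    by (intro has_integral_mult_right) (simp add: o_def cis_mult[symmetric])
  moreover have "- \<i> * (2 * of_real pi * \<i>) = of_real (2 * pi)" by (simp add: complex_eq_iff)
  moreover have "- \<i> * (\<i> * x) = x" for x by (simp add: complex_eq_iff)
  ultimately show ?thesis by (simp only:)
qed

text \<open>
Integrate the primitive of \<open>divided_difference_laplace_has_field_derivative\<close> along
\<open>w = ln r + \<phi> * \<i>\<close>, \<open>- pi \<le> \<phi> \<le> pi\<close>. At the ends it becomes \<open>- exp (- r * t)\<close> times the integral of
\<open>exp (- r * s) * D (- s)\<close> over the lower, respectively upper bank. The two integrands differ only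
for \<open>s > a\<close>, and there by the jump of \<open>F\<close> divided by \<open>- s - t\<close>.
\<close>

lemma H_space_inversion:
  assumes F: "F \<in> H_space a T" and a: "a > 0" and z: "z > 0" and r: "r > 0"
  shows "((\<lambda>\<phi>. \<i> * exp (of_real (z - a) * of_real r * cis \<phi>) * laplace_log F (of_real (ln r) + of_real \<phi> * \<i>))
    has_integral 2 * of_real pi * \<i> * F (of_real (z - a))
      - T * of_real (exp (- r * z)) * (LBINT s:{0<..}. of_real (exp (- r * s)) * F (of_real s) / of_real (z + s)))
    {- pi..pi}"
proof -
  define t :: complex where "t = of_real (z - a)"
  define D where "D = (\<lambda>s. if s = t then deriv F t else (F s - F t) / (s - t))"
  have Fs: "slit_function a F" by (rule H_space_slit_function[OF F a])
  have "t \<noteq> of_real x" if "x \<le> - a" for x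
    using that z unfolding t_def of_real_eq_iff by auto
  then have t: "t \<in> cut_plane a" by (auto simp: cut_plane_def)
  have Ds: "slit_function a D" unfolding D_def by (rule slit_function_divided_difference[OF Fs t])
  have "\<forall>s>0. \<exists>u l. (F \<longlongrightarrow> u) (at (- of_real (a + s)) within {t. Im t > 0}) \<and>
        (F \<longlongrightarrow> l) (at (- of_real (a + s)) within {t. Im t < 0}) \<and> u = l - T * F (of_real s)"
    using F by (simp add: H_space_def)
  then obtain u l where u: "\<And>s. s > 0 \<Longrightarrow> (F \<longlongrightarrow> u s) (at (- of_real (a + s)) within {t. Im t > 0})"
    and l: "\<And>s. s > 0 \<Longrightarrow> (F \<longlongrightarrow> l s) (at (- of_real (a + s)) within {t. Im t < 0})"
    and ul: "\<And>s. s > 0 \<Longrightarrow> u s = l s - T * F (of_real s)"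
    by metis
  define L where "L v s = (v s - F t) / (- of_real (a + s) - t)" for v :: "real \<Rightarrow> complex" and s
  have pt: "- of_real (a + s) \<noteq> t" if "s > 0" for s
    using that z unfolding t_def of_real_minus[symmetric] of_real_eq_iff by auto
  have DL: "(D \<longlongrightarrow> L v s) (at (- of_real (a + s)) within A)"
    if "s > 0" "(F \<longlongrightarrow> v s) (at (- of_real (a + s)) within A)" for v s A
  proof (rule Lim_transform_eventually)
    show "((\<lambda>x. (F x - F t) / (x - t)) \<longlongrightarrow> L v s) (at (- of_real (a + s)) within A)"
      unfolding L_def using pt[OF that(1)] by (intro tendsto_intros that(2)) auto
    show "\<forall>\<^sub>F x in at (- of_real (a + s)) within A. (F x - F t) / (x - t) = D x"
      using tendsto_imp_eventually_ne[OF tendsto_ident_at pt[OF that(1)]]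
      by (rule eventually_mono) (simp add: D_def)
  qed
  define B where "B v = (\<lambda>s. of_real (exp (- r * s)) * (if s < a then D (- of_real s) else L v (s - a)))"
    for v :: "real \<Rightarrow> complex"
  define X where "X v = (LBINT s:{0..} - {a}. B v s)" for v
  define E where "E w = exp (t * exp w) * exp (- w) * ray_laplace D 0 w" for w
  let ?w = "\<lambda>\<phi>. of_real (ln r) + of_real \<phi> * \<i> :: complex"
  have ew: "exp (?w \<phi>) = of_real r * cis \<phi>" for \<phi>
    using r by (simp add: exp_add cis_conv_exp exp_of_real mult.commute)
  have condl: "(D \<longlongrightarrow> L l s) (at (- of_real (a + s)) within {t. 1 * Im t < 0})" if "s > 0" for s
    using DL[of s l "{t. Im t < 0}", OF that l[OF that]] by simp
  have condu: "(D \<longlongrightarrow> L u s) (at (- of_real (a + s)) within {t. - 1 * Im t < 0})" if "s > 0" for s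
    using DL[of s u "{t. Im t > 0}", OF that u[OF that]] by simp
  have lower: "set_integrable lborel ({0..} - {a}) (B l)"
      "((\<lambda>\<phi>. ray_laplace D 0 (?w (1 * \<phi>))) \<longlongrightarrow> of_real r * X l) (at_left pi)"
    unfolding B_def X_def
    by (rule ray_laplace_bank_limit(1)[OF Ds a r disjI1[OF refl] condl], assumption,
        rule ray_laplace_bank_limit(2)[OF Ds a r disjI1[OF refl] condl], assumption)
  have upper: "set_integrable lborel ({0..} - {a}) (B u)"
      "((\<lambda>\<phi>. ray_laplace D 0 (?w (- 1 * \<phi>))) \<longlongrightarrow> of_real r * X u) (at_left pi)"
    unfolding B_def X_def
    by (rule ray_laplace_bank_limit(1)[OF Ds a r disjI2[OF refl] condu], assumption,
        rule ray_laplace_bank_limit(2)[OF Ds a r disjI2[OF refl] condu], assumption)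
  have Elim: "((\<lambda>\<phi>. E (?w (\<kappa> * \<phi>))) \<longlongrightarrow> - exp (- (t * of_real r)) * X v) (at_left pi)"
    if \<kappa>: "\<kappa> = 1 \<or> \<kappa> = - 1"
      and R: "((\<lambda>\<phi>. ray_laplace D 0 (?w (\<kappa> * \<phi>))) \<longlongrightarrow> of_real r * X v) (at_left pi)" for \<kappa> v
  proof -
    have "((\<lambda>\<phi>. E (?w (\<kappa> * \<phi>))) \<longlongrightarrow>
        exp (t * exp (?w (\<kappa> * pi))) * exp (- ?w (\<kappa> * pi)) * (of_real r * X v)) (at_left pi)"
      unfolding E_def by (intro tendsto_intros R)
    moreover have e: "exp (?w (\<kappa> * pi)) = - of_real r" unfolding ew using \<kappa> by (auto simp: complex_eq_iff)
    moreover have "exp (- ?w (\<kappa> * pi)) * (of_real r * X v) = - X v"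
      unfolding exp_minus e using r by simp
    ultimately show ?thesis by (simp only: mult.assoc mult_minus_right mult_minus_left)
  qed
  \<comment> \<open>The primitive along the arc, completed by its limits at the two ends.\<close>
  define e where "e \<phi> = (if \<phi> = pi then - exp (- (t * of_real r)) * X l
      else if \<phi> = - pi then - exp (- (t * of_real r)) * X u else E (?w \<phi>))" for \<phi> :: real
  define e' where "e' \<phi> = \<i> * - (exp (t * (of_real r * cis \<phi>)) * (laplace_log F (?w \<phi>) - F t))" for \<phi> :: real
  have der: "(e has_vector_derivative e' \<phi>) (at \<phi>)" if \<phi>: "\<phi> \<in> {- pi<..<pi}" for \<phi>
  proof (rule has_vector_derivative_transform_within_open)
    have wd: "(?w has_vector_derivative \<i>) (at \<phi>)"
      by (auto intro!: derivative_eq_intros simp: has_vector_derivative_def scaleR_conv_of_real)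
    have "\<bar>Im (?w \<phi>)\<bar> < pi" using \<phi> by auto
    then have Ed: "(E has_field_derivative - (exp (t * exp (?w \<phi>)) * (ray_laplace F 0 (?w \<phi>) - F t))) (at (?w \<phi>))"
      and Q: "laplace_log F (?w \<phi>) = ray_laplace F 0 (?w \<phi>)"
      unfolding E_def D_def
      by (rule divided_difference_laplace_has_field_derivative[OF Fs a t], rule laplace_log_continuation(3)[OF Fs a])
    then show "((E \<circ> ?w) has_vector_derivative e' \<phi>) (at \<phi>)"
      using field_vector_diff_chain_at[OF wd Ed] by (simp add: e'_def ew Q)
    show "(E \<circ> ?w) x = e x" if "x \<in> {- pi<..<pi}" for x using that by (auto simp: e_def)
  qed (use \<phi> in auto)
  have cont: "continuous_on {- pi..pi} e"
    unfolding continuous_on_eq_continuous_within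
  proof
    fix \<phi> assume "\<phi> \<in> {- pi..pi}"
    then consider "\<phi> \<in> {- pi<..<pi}" | "\<phi> = pi" | "\<phi> = - pi" by fastforce
    then show "continuous (at \<phi> within {- pi..pi}) e"
    proof cases
      case 1
      then show ?thesis using der has_vector_derivative_continuous continuous_at_imp_continuous_at_within by blast
    next
      case 2
      have "(e \<longlongrightarrow> - exp (- (t * of_real r)) * X l) (at_left pi)"
      proof (rule Lim_transform_eventually[OF Elim[OF _ lower(2)]])
        show "\<forall>\<^sub>F \<phi> in at_left pi. E (?w (1 * \<phi>)) = e \<phi>"
          using eventually_at_left_real[OF pi_gt_zero] by (rule eventually_mono) (auto simp: e_def)
      qed simp
      then show ?thesis unfolding 2 continuous_within by (simp add: e_def at_within_Icc_at_left)
    next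
      case 3
      have "((\<lambda>\<phi>. e (- \<phi>)) \<longlongrightarrow> - exp (- (t * of_real r)) * X u) (at_left pi)"
      proof (rule Lim_transform_eventually[OF Elim[OF _ upper(2)]])
        show "\<forall>\<^sub>F \<phi> in at_left pi. E (?w (- 1 * \<phi>)) = e (- \<phi>)"
          using eventually_at_left_real[OF pi_gt_zero] by (rule eventually_mono) (auto simp: e_def)
      qed simp
      then have "(e \<longlongrightarrow> - exp (- (t * of_real r)) * X u) (at_right (- pi))"
        by (simp add: at_right_minus[of "- pi"] filterlim_filtermap)
      then show ?thesis unfolding 3 continuous_within by (simp add: e_def at_within_Icc_at_right)
    qed
  qed
  have int_e': "(e' has_integral e pi - e (- pi)) {- pi..pi}"
    by (rule fundamental_theorem_of_calculus_interior[OF _ cont der]) auto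
  have XX: "X l - X u = - T * of_real (exp (- r * a)) *
      (LBINT s:{0<..}. of_real (exp (- r * s)) * F (of_real s) / of_real (z + s))"
  proof -
    define f where "f s = indicator {a<..} s *\<^sub>R
      (- T * (of_real (exp (- r * s)) * F (of_real (s - a)) / of_real (z + (s - a))))" for s :: real
    have "X l - X u = (LBINT s:{0..} - {a}. B l s - B u s)"
      unfolding X_def by (rule set_integral_diff(2)[symmetric, OF lower(1) upper(1)])
    also have "\<dots> = (LBINT s. f s)"
      unfolding set_lebesgue_integral_def
    proof (rule Bochner_Integration.integral_cong[OF refl])
      fix s :: real
      consider "s < a" | "s = a" | "s > a" by linarith
      then show "indicator ({0..} - {a}) s *\<^sub>R (B l s - B u s) = f s"
      proof cases
        case 3
        define d where "d = (of_real (z + (s - a)) :: complex)"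
        have d: "d \<noteq> 0" "- of_real (a + (s - a)) - t = - d"
          using 3 z unfolding d_def of_real_eq_0_iff by (auto simp: t_def)
        have "L l (s - a) - L u (s - a) = (l (s - a) - u (s - a)) / - d"
          unfolding L_def d(2) by (simp add: diff_divide_distrib)
        also have "\<dots> = - T * F (of_real (s - a)) / d"
          using ul[of "s - a"] 3 by simp
        finally have "L l (s - a) - L u (s - a) = - T * F (of_real (s - a)) / d" .
        moreover have "B l s - B u s = of_real (exp (- r * s)) * (L l (s - a) - L u (s - a))"
          using 3 by (simp add: B_def algebra_simps)
        ultimately show ?thesis using 3 a by (simp add: f_def d_def[symmetric] del: of_real_add of_real_diff)
      qed (use a in \<open>auto simp: f_def B_def\<close>)
    qed
    also have "\<dots> = (LBINT s. f (a + 1 * s))"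
      using lborel_integral_real_affine[of 1 f a] by simp
    also have "\<dots> = (LBINT s:{0<..}. - T * of_real (exp (- r * a)) *
        (of_real (exp (- r * s)) * F (of_real s) / of_real (z + s)))"
      unfolding set_lebesgue_integral_def
    proof (rule Bochner_Integration.integral_cong[OF refl])
      fix s :: real
      have "exp (- r * (a + 1 * s)) = exp (- r * a) * exp (- r * s)"
        by (simp add: exp_add[symmetric] algebra_simps)
      then show "f (a + 1 * s) = indicator {0<..} s *\<^sub>R (- T * of_real (exp (- r * a)) *
        (of_real (exp (- r * s)) * F (of_real s) / of_real (z + s)))"
        by (simp add: f_def indicator_def)
    qed
    finally show ?thesis by (simp only: set_integral_mult_right)
  qed
  have EE: "exp (- (t * of_real r)) * of_real (exp (- r * a)) = of_real (exp (- r * z))"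
    by (simp add: t_def exp_of_real[symmetric] exp_add[symmetric] algebra_simps)
  have VV: "e pi - e (- pi) = - exp (- (t * of_real r)) * (X l - X u)"
    by (simp add: e_def algebra_simps)
  have "e pi - e (- pi) = T * of_real (exp (- r * z)) *
      (LBINT s:{0<..}. of_real (exp (- r * s)) * F (of_real s) / of_real (z + s))"
    unfolding VV XX EE[symmetric] by (simp only: mult_minus_left mult_minus_right minus_minus mult_ac)
  with int_e' have "(e' has_integral T * of_real (exp (- r * z)) *
      (LBINT s:{0<..}. of_real (exp (- r * s)) * F (of_real s) / of_real (z + s))) {- pi..pi}"
    by (simp only:)
  then have "((\<lambda>\<phi>. \<i> * F t * exp (t * of_real r * cis \<phi>) - e' \<phi>) has_integral
      \<i> * F t * of_real (2 * pi) - T * of_real (exp (- r * z)) *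
      (LBINT s:{0<..}. of_real (exp (- r * s)) * F (of_real s) / of_real (z + s))) {- pi..pi}"
    by (intro has_integral_diff has_integral_mult_right has_integral_exp_cis)
  moreover have "(\<lambda>\<phi>. \<i> * F t * exp (t * of_real r * cis \<phi>) - e' \<phi>) =
      (\<lambda>\<phi>. \<i> * exp (of_real (z - a) * of_real r * cis \<phi>) * laplace_log F (of_real (ln r) + of_real \<phi> * \<i>))"
    by (auto simp: fun_eq_iff e'_def t_def algebra_simps)
  ultimately show ?thesis by (simp add: t_def mult_ac)
qed

section \<open>An exponential integral and the Euler constant\<close>

text \<open>
The limit is the derivative of \<open>Gamma\<close> at \<open>1\<close>.
\<close>

lemma Gamma_minus_inverse_tendsto:
  "((\<lambda>p::real. Gamma p - 1 / p) \<longlongrightarrow> - euler_mascheroni) (at_right 0)"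
proof -
  have "(Gamma has_field_derivative Gamma (1::real) * Digamma 1) (at 1)"
    by (rule has_field_derivative_Gamma) auto
  then have "((\<lambda>h. (Gamma (1 + h) - Gamma 1) / h) \<longlongrightarrow> - (euler_mascheroni::real)) (at 0)"
    by (simp add: DERIV_def)
  then have "((\<lambda>h. (Gamma (1 + h) - Gamma 1) / h) \<longlongrightarrow> - (euler_mascheroni::real)) (at_right 0)"
    by (rule tendsto_within_subset) auto
  then show ?thesis
  proof (rule Lim_transform_eventually)
    have "\<forall>\<^sub>F p in at_right (0::real). p > 0" by (rule eventually_at_right_less)
    then show "\<forall>\<^sub>F p in at_right (0::real). (Gamma (1 + p) - Gamma 1) / p = Gamma p - 1 / p"
    proof eventually_elim
      case (elim p)
      then have "Gamma (p + 1) = p * Gamma p" by (intro Gamma_plus1) (auto elim!: nonpos_Ints_cases)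
      then show ?case using elim by (simp add: field_simps)
    qed
  qed
qed

lemma set_integral_Ioi_eq_Ici:
  fixes f :: "real \<Rightarrow> 'a::{banach,second_countable_topology}"
  shows "(LBINT s:{c<..}. f s) = (LBINT s:{c..}. f s)"
  by (rule set_integral_discrete_difference[of "{c}"]) auto

text \<open>
Subtracting the cutoff removes the singularity of \<open>exp (- s) / s\<close> at \<open>0\<close>. One dominating function \<open>G\<close> serves both
regularisations of \<open>1 / s\<close>, by \<open>s powr (p - 1)\<close> and by \<open>1 / (z + s)\<close>.
\<close>

lemma
  fixes k G :: "real \<Rightarrow> real"
  defines "k \<equiv> \<lambda>s. exp (- s) - indicator {..<1} s"
  defines "G \<equiv> \<lambda>s. indicator {..<1} s + exp (- 1 * s)"
  shows exp_cutoff_bound: "s > 0 \<Longrightarrow> \<bar>k s\<bar> / s \<le> G s"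
    and exp_cutoff_powr_bound: "s > 0 \<Longrightarrow> 0 < p \<Longrightarrow> p < 1 \<Longrightarrow> \<bar>k s\<bar> * s powr (p - 1) \<le> G s"
    and exp_cutoff_dominating: "set_integrable lborel {0<..} G"
proof -
  have small: "\<bar>k s\<bar> \<le> s" if "0 < s" "s < 1" for s
  proof -
    have "1 - exp (- s) \<le> s" using exp_ge_add_one_self[of "- s"] by simp
    moreover have "exp (- s) \<le> 1" using that by simp
    ultimately show ?thesis using that by (simp add: k_def)
  qed
  show "\<bar>k s\<bar> / s \<le> G s" if s: "s > 0" for s
  proof (cases "s < 1")
    case True
    then have "\<bar>k s\<bar> / s \<le> 1" using small[of s] s by simp
    then show ?thesis using True by (simp add: G_def add_increasing2)
  next
    case False
    then have "\<bar>k s\<bar> / s \<le> exp (- s) / 1" unfolding k_def by (intro frac_le) auto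
    then show ?thesis using False by (simp add: G_def)
  qed
  show "\<bar>k s\<bar> * s powr (p - 1) \<le> G s" if s: "s > 0" and p: "0 < p" "p < 1" for s p
  proof (cases "s < 1")
    case True
    have "\<bar>k s\<bar> * s powr (p - 1) \<le> s * s powr (p - 1)"
      using small[of s] True s by (intro mult_right_mono) auto
    also have "\<dots> = s powr p" using s by (simp add: powr_diff)
    also have "\<dots> \<le> 1" using s p True by (simp add: powr_le1)
    finally show ?thesis using True by (simp add: G_def add_increasing2)
  next
    case False
    then have "s powr (p - 1) \<le> 1" using p powr_mono[of "p - 1" 0 s] by simp
    then have "\<bar>k s\<bar> * s powr (p - 1) \<le> exp (- s) * 1"
      using False by (intro mult_mono) (auto simp: k_def)
    then show ?thesis using False by (simp add: G_def)
  qed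
  have "set_integrable lborel {0<..} (\<lambda>s::real. exp (- 1 * s))"
    by (rule set_integrable_subset[OF set_integrable_exp_minus[where b = 0]]) auto
  moreover have "set_integrable lborel {0<..} (indicator {..<1::real} :: real \<Rightarrow> real)"
  proof -
    have "integrable lborel (indicator {0<..<1::real} :: real \<Rightarrow> real)" by simp
    moreover have "(\<lambda>s. indicator {0<..} s *\<^sub>R indicator {..<1} s) = (indicator {0<..<1::real} :: real \<Rightarrow> real)"
      by (auto simp: indicator_def fun_eq_iff)
    ultimately show ?thesis by (simp add: set_integrable_def)
  qed
  ultimately show "set_integrable lborel {0<..} G" unfolding G_def by (intro set_integral_add)
qed

text \<open>
Insert \<open>s powr p\<close>. The Mellin integral then splits into \<open>Gamma p\<close> and \<open>1 / p\<close>, and \<open>p\<close> tends to \<open>0\<close>.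
\<close>

lemma exp_cutoff_integral:
  "(LBINT s:{0<..}. (exp (- s) - indicator {..<1} s) / s) = - (euler_mascheroni :: real)"
proof -
  let ?k = "\<lambda>s::real. exp (- s) - indicator {..<1} s"
  have mellin: "(LBINT s:{0<..}. ?k s * s powr (p - 1)) = Gamma p - 1 / p" if p: "0 < p" for p :: real
  proof -
    have i1: "set_integrable lborel {0..} (\<lambda>s. s powr (p - 1) / exp s)"
      using Gamma_integral_real[OF p] by (intro set_integrable_lborel_nonneg) (auto simp: integrable_on_def)
    have v1: "(LBINT s:{0..}. s powr (p - 1) / exp s) = Gamma p"
      using set_borel_integral_eq_integral(2)[OF i1] Gamma_integral_real[OF p] by (simp add: integral_unique)
    have h2: "((\<lambda>s. s powr (p - 1)) has_integral (1 / p)) {0..1}"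
      using has_integral_powr_from_0[of "p - 1" 1] p by simp
    have i2: "set_integrable lborel {0..1} (\<lambda>s. s powr (p - 1))"
      using h2 by (intro set_integrable_lborel_nonneg) (auto simp: integrable_on_def)
    have v2: "(LBINT s:{0..1}. s powr (p - 1)) = 1 / p"
      using set_borel_integral_eq_integral(2)[OF i2] h2 by (simp add: integral_unique)
    have j1: "set_integrable lborel {0<..} (\<lambda>s. s powr (p - 1) / exp s)"
      using i1 by (rule set_integrable_subset) auto
    have eq: "(\<lambda>s. indicator {0<..} s *\<^sub>R (indicator {..<1} s * s powr (p - 1))) =
        (\<lambda>s. indicator {0<..<1} s *\<^sub>R (s powr (p - 1)))"
      by (auto simp: indicator_def fun_eq_iff)
    have "set_integrable lborel {0<..<1} (\<lambda>s. s powr (p - 1))"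
      using i2 by (rule set_integrable_subset) auto
    then have j2: "set_integrable lborel {0<..} (\<lambda>s. indicator {..<1} s * s powr (p - 1))"
      unfolding set_integrable_def eq .
    have "(LBINT s:{0<..}. indicator {..<1} s * s powr (p - 1)) = (LBINT s:{0<..<1}. s powr (p - 1))"
      unfolding set_lebesgue_integral_def eq ..
    also have "\<dots> = (LBINT s:{0..1}. s powr (p - 1))"
      by (rule set_integral_discrete_difference[of "{0,1}"]) auto
    finally have w2: "(LBINT s:{0<..}. indicator {..<1} s * s powr (p - 1)) = 1 / p" using v2 by simp
    have "(LBINT s:{0<..}. ?k s * s powr (p - 1)) =
        (LBINT s:{0<..}. s powr (p - 1) / exp s - indicator {..<1} s * s powr (p - 1))"
      by (intro set_lebesgue_integral_cong) (auto simp: exp_minus field_simps)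
    also have "\<dots> = Gamma p - 1 / p"
      by (subst set_integral_diff(2)[OF j1 j2])
        (simp only: w2 v1 set_integral_Ioi_eq_Ici[of 0 "\<lambda>s. s powr (p - 1) / exp s"])
    finally show ?thesis .
  qed
  have near: "\<forall>\<^sub>F p in at_right (0::real). 0 < p \<and> p < 1"
    using eventually_at_right_real[of 0 "1::real"] by auto
  have "((\<lambda>p. LBINT s:{0<..}. ?k s * s powr (p - 1)) \<longlongrightarrow> (LBINT s:{0<..}. ?k s / s)) (at_right 0)"
  proof (rule set_dominated_convergence_within(2)[OF _ _ _ exp_cutoff_dominating])
    show "\<forall>\<^sub>F p in at_right 0. set_borel_measurable lborel {0<..} (\<lambda>s. ?k s * s powr (p - 1)) \<and>
        (\<forall>s\<in>{0<..}. norm (?k s * s powr (p - 1)) \<le> indicator {..<1} s + exp (- 1 * s))"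
      using near
    proof eventually_elim
      case (elim p)
      then show ?case using exp_cutoff_powr_bound[of _ p]
        by (auto simp: set_borel_measurable_def abs_mult)
    qed
    show "((\<lambda>p. ?k s * s powr (p - 1)) \<longlongrightarrow> ?k s / s) (at_right 0)" if "s \<in> {0<..}" for s
    proof -
      have "((\<lambda>p. ?k s * s powr (p - 1)) \<longlongrightarrow> ?k s * s powr (0 - 1)) (at_right 0)"
        using that by (intro tendsto_intros) auto
      then show ?thesis using that by (simp add: powr_minus divide_inverse)
    qed
  qed auto
  moreover have "((\<lambda>p. LBINT s:{0<..}. ?k s * s powr (p - 1)) \<longlongrightarrow> - euler_mascheroni) (at_right 0)"
    by (rule Lim_transform_eventually[OF Gamma_minus_inverse_tendsto])
      (rule eventually_mono[OF near], simp add: mellin)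
  ultimately show ?thesis by (rule tendsto_unique[rotated]) simp
qed

lemma exp_stieltjes_integrable:
  fixes r z :: real
  assumes "r > 0" "z > 0"
  shows "set_integrable lborel {0<..} (\<lambda>s. exp (- r * s) / (z + s))"
proof -
  have "set_integrable lborel {0<..} (\<lambda>s. 1 / z * exp (- r * s))"
    using assms by (intro set_integrable_mult_right set_integrable_subset[OF set_integrable_exp_minus[where b = 0]]) auto
  then show ?thesis
  proof (rule set_integrable_bound)
    show "AE s in lborel. s \<in> {0<..} \<longrightarrow> norm (exp (- r * s) / (z + s)) \<le> norm (1 / z * exp (- r * s))"
      using assms by (auto intro!: AE_I2 divide_left_mono simp: field_simps)
  qed (auto simp: set_borel_measurable_def)
qed

text \<open>
Subtracting the cutoff makes the integral converge at \<open>z = 0\<close>; the cutoff itself contributes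
\<open>\<integral> 1 / (z + s) ds = ln (z + 1) - ln z\<close> over the unit interval.
\<close>

lemma exp_stieltjes_tendsto_unit:
  "((\<lambda>z. (LBINT s:{0<..}. exp (- s) / (z + s)) + ln z) \<longlongrightarrow> - (euler_mascheroni :: real)) (at_right 0)"
proof -
  let ?k = "\<lambda>s::real. exp (- s) - indicator {..<1} s"
  have pos: "\<forall>\<^sub>F z in at_right (0::real). z > 0" by (rule eventually_at_right_less)
  have "((\<lambda>z. LBINT s:{0<..}. ?k s / (z + s)) \<longlongrightarrow> (LBINT s:{0<..}. ?k s / (0 + s))) (at_right 0)"
  proof (rule set_dominated_convergence_within(2)[OF _ _ _ exp_cutoff_dominating])
    show "\<forall>\<^sub>F z in at_right 0. set_borel_measurable lborel {0<..} (\<lambda>s. ?k s / (z + s)) \<and>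
        (\<forall>s\<in>{0<..}. norm (?k s / (z + s)) \<le> indicator {..<1} s + exp (- 1 * s))"
      using pos
    proof eventually_elim
      case (elim z)
      have "norm (?k s / (z + s)) \<le> indicator {..<1} s + exp (- 1 * s)" if "s > 0" for s
      proof -
        have "norm (?k s / (z + s)) \<le> \<bar>?k s\<bar> / s"
          using that elim by (auto intro!: divide_left_mono)
        then show ?thesis using exp_cutoff_bound[OF that] by simp
      qed
      then show ?case by (auto simp: set_borel_measurable_def)
    qed
    show "((\<lambda>z. ?k s / (z + s)) \<longlongrightarrow> ?k s / (0 + s)) (at_right 0)" if "s \<in> {0<..}" for s
      using that by (intro tendsto_intros) auto
  qed auto
  then have lim: "((\<lambda>z. (LBINT s:{0<..}. ?k s / (z + s)) + ln (z + 1)) \<longlongrightarrow> - euler_mascheroni + ln (0 + 1)) (at_right 0)"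
    by (intro tendsto_intros) (simp_all add: exp_cutoff_integral)
  have "\<forall>\<^sub>F z in at_right 0. (LBINT s:{0<..}. ?k s / (z + s)) + ln (z + 1) =
      (LBINT s:{0<..}. exp (- s) / (z + s)) + ln z"
    using pos
  proof eventually_elim
    case (elim z)
    have h: "((\<lambda>s. 1 / (z + s)) has_integral (ln (z + 1) - ln (z + 0))) {0..1}"
      using elim by (intro fundamental_theorem_of_calculus)
        (auto intro!: derivative_eq_intros simp: has_real_derivative_iff_has_vector_derivative[symmetric])
    have i2: "set_integrable lborel {0..1} (\<lambda>s. 1 / (z + s))"
      using h elim by (intro set_integrable_lborel_nonneg) (auto simp: integrable_on_def)
    have v2: "(LBINT s:{0..1}. 1 / (z + s)) = ln (z + 1) - ln z"
      using set_borel_integral_eq_integral(2)[OF i2] h by (simp add: integral_unique)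
    have eq: "(\<lambda>s. indicator {0<..} s *\<^sub>R (indicator {..<1} s * (1 / (z + s)))) =
        (\<lambda>s. indicator {0<..<1} s *\<^sub>R (1 / (z + s)))"
      by (auto simp: indicator_def fun_eq_iff)
    have "set_integrable lborel {0<..<1} (\<lambda>s. 1 / (z + s))"
      using i2 by (rule set_integrable_subset) auto
    then have j2: "set_integrable lborel {0<..} (\<lambda>s. indicator {..<1} s * (1 / (z + s)))"
      unfolding set_integrable_def eq .
    have "(LBINT s:{0<..}. indicator {..<1} s * (1 / (z + s))) = (LBINT s:{0<..<1}. 1 / (z + s))"
      unfolding set_lebesgue_integral_def eq ..
    also have "\<dots> = (LBINT s:{0..1}. 1 / (z + s))"
      by (rule set_integral_discrete_difference[of "{0,1}"]) auto
    finally have w2: "(LBINT s:{0<..}. indicator {..<1} s * (1 / (z + s))) = ln (z + 1) - ln z"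
      using v2 by simp
    have j1: "set_integrable lborel {0<..} (\<lambda>s. exp (- s) / (z + s))"
      using exp_stieltjes_integrable[of 1 z] elim by simp
    have "(LBINT s:{0<..}. ?k s / (z + s)) =
        (LBINT s:{0<..}. exp (- s) / (z + s) - indicator {..<1} s * (1 / (z + s)))"
      by (simp add: diff_divide_distrib)
    then show ?case by (simp only: set_integral_diff(2)[OF j1 j2] w2)
  qed
  from Lim_transform_eventually[OF lim this] show ?thesis by simp
qed

lemma exp_stieltjes_tendsto:
  fixes r :: real
  assumes r: "r > 0"
  shows "((\<lambda>z. (LBINT s:{0<..}. exp (- r * s) / (z + s)) + ln z) \<longlongrightarrow> - euler_mascheroni - ln r) (at_right 0)"
proof -
  have "filterlim (\<lambda>z. r * z) (at_right 0) (at_right 0)"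
    unfolding filterlim_at
  proof (intro conjI)
    show "\<forall>\<^sub>F z in at_right 0. r * z \<in> {0<..} \<and> r * z \<noteq> 0"
      using eventually_at_right_less[of 0] by (rule eventually_mono) (use r in auto)
    show "((\<lambda>z. r * z) \<longlongrightarrow> 0) (at_right 0)" by (rule tendsto_eq_intros | simp)+
  qed
  from filterlim_compose[OF exp_stieltjes_tendsto_unit this]
  have "((\<lambda>z. (LBINT s:{0<..}. exp (- s) / (r * z + s)) + ln (r * z) - ln r) \<longlongrightarrow> - euler_mascheroni - ln r) (at_right 0)"
    by (intro tendsto_intros)
  then show ?thesis
  proof (rule Lim_transform_eventually)
    show "\<forall>\<^sub>F z in at_right 0. (LBINT s:{0<..}. exp (- s) / (r * z + s)) + ln (r * z) - ln r =
        (LBINT s:{0<..}. exp (- r * s) / (z + s)) + ln z"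
      using eventually_at_right_less[of 0]
    proof eventually_elim
      case (elim z)
      have "(LBINT s:{0<..}. exp (- s) / (r * z + s)) =
          \<bar>r\<bar> *\<^sub>R (LBINT s. indicator {0<..} (0 + r * s) *\<^sub>R (exp (- (0 + r * s)) / (r * z + (0 + r * s))))"
        unfolding set_lebesgue_integral_def using r by (intro lborel_integral_real_affine) auto
      also have "\<dots> = (LBINT s. r *\<^sub>R (indicator {0<..} (0 + r * s) *\<^sub>R (exp (- (0 + r * s)) / (r * z + (0 + r * s)))))"
        using r by (simp only: abs_of_pos integral_scaleR_right)
      also have "\<dots> = (LBINT s:{0<..}. exp (- r * s) / (z + s))"
        unfolding set_lebesgue_integral_def
        using r by (intro Bochner_Integration.integral_cong refl)
          (auto simp: indicator_def zero_less_mult_iff distrib_left[symmetric])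
      finally show ?case using r elim by (simp add: ln_mult)
    qed
  qed
qed

section \<open>The tail of the Laplace transform and the limit at the end of the cut\<close>

text \<open>
The difference quotient at \<open>0\<close> replaces \<open>(f s - f 0) / s\<close> below: it is again a function of the same
kind, so the growth bounds apply to it without a separate discussion of small \<open>s\<close>.
\<close>

lemma slit_function_difference_quotient_at_zero:
  assumes "slit_function a f" "a > 0"
  obtains D where "slit_function a D" "\<And>s. s * D s = f s - f 0"
proof -
  have "0 \<in> cut_plane a" using assms(2) by (auto simp: cut_plane_def)
  from slit_function_divided_difference[OF assms(1) this] show thesis
    by (rule that) simp
qed

lemma slit_function_positive_axis_bound:
  assumes "slit_function a f" "a > 0" "\<epsilon> > 0"
  obtains C where "C \<ge> 0" "\<And>s::real. s \<ge> 0 \<Longrightarrow> norm (f (of_real s)) \<le> C * exp (\<epsilon> * s)"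
proof -
  have "0 < pi / 2" "pi / 2 < pi" by simp_all
  from slit_function_sector_bound[OF assms(1,2) this assms(3)]
  obtain C where C: "C \<ge> 0" "\<And>s v. s \<ge> 0 \<Longrightarrow> \<bar>Im v\<bar> \<le> pi / 2 \<Longrightarrow>
      norm (f (of_real s * exp v)) \<le> C * exp (\<epsilon> * (s * exp (Re v)))" by blast
  show thesis
  proof (rule that[OF C(1)])
    show "norm (f (of_real s)) \<le> C * exp (\<epsilon> * s)" if "s \<ge> 0" for s :: real
      using C(2)[OF that, of 0] by simp
  qed
qed

lemma slit_function_positive_axis_measurable:
  assumes "slit_function a D" "a > 0"
  shows "(\<lambda>s. indicator {0<..} s *\<^sub>R D (of_real s)) \<in> borel_measurable borel"
proof (rule borel_measurable_continuous_on_indicator)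
  show "continuous_on {0<..} (\<lambda>s. D (of_real s))"
    by (rule continuous_on_compose2[OF slit_function_continuous_on[OF assms(1)]])
      (use assms in \<open>auto intro!: continuous_intros simp: cut_plane_def\<close>)
qed auto

text \<open>
The Laplace integral of \<open>f - f 0\<close>, since \<open>s * D s = f s - f 0\<close>.
\<close>

lemma laplace_remainder:
  assumes f: "slit_function a f" "a > 0" and x: "x > 0"
    and D: "\<And>s. s * D s = f s - f 0"
  shows "(laplace_L f (of_real x) - f 0) / of_real x =
    (LBINT s:{0<..}. of_real (exp (- x * s)) * (of_real s * D (of_real s)))"
proof -
  let ?w = "of_real (ln x) :: complex"
  have e: "exp ?w = of_real x" using x by (metis exp_ln exp_of_real)
  have "laplace_L f (of_real x) - f 0 = ray_laplace f 0 ?w - f 0"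
    unfolding laplace_L_def using x laplace_log_continuation(3)[OF f, of ?w] by (simp add: Ln_of_real)
  also have "\<dots> = (LBINT s:{0..}. exp (- (of_real s * exp ?w)) * (f (of_real s * exp (?w - ?w)) - f 0) * exp ?w)"
    by (rule ray_laplace_minus_const(2)[OF f, symmetric]) auto
  also have "\<dots> = (LBINT s:{0..}. of_real (exp (- x * s)) * (of_real s * D (of_real s)) * of_real x)"
    unfolding e D by (simp add: exp_of_real[symmetric] mult.commute)
  also have "\<dots> = (LBINT s:{0<..}. of_real (exp (- x * s)) * (of_real s * D (of_real s))) * of_real x"
    by (simp only: set_integral_mult_left set_integral_Ioi_eq_Ici)
  finally have "laplace_L f (of_real x) - f 0 =
      (LBINT s:{0<..}. of_real (exp (- x * s)) * (of_real s * D (of_real s))) * of_real x" .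
  moreover have "complex_of_real x \<noteq> 0" using x by simp
  ultimately show ?thesis by (simp only: nonzero_mult_div_cancel_right not_False_eq_True)
qed

text \<open>
Integrate the formula for the remainder over \<open>x \<ge> r\<close> under the integral sign: the kernel
\<open>s * exp (- x * s)\<close> has the integral \<open>exp (- r * s)\<close>. Absolute integrability of the double integral is
clear when \<open>x\<close> is integrated first, and it yields the integrability of the remainder.
\<close>

lemma laplace_tail_integral:
  assumes f: "slit_function a f" "a > 0" and r: "r > 0"
    and slit: "slit_function a D" and D: "\<And>s. s * D s = f s - f 0"
  shows "set_integrable lborel {r..} (\<lambda>x. (laplace_L f (of_real x) - f 0) / of_real x)"
    and "(LBINT x:{r..}. (laplace_L f (of_real x) - f 0) / of_real x) =
      (LBINT s:{0<..}. of_real (exp (- r * s)) * D (of_real s))"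
proof -
  obtain C where C: "C \<ge> 0" "\<And>s::real. s \<ge> 0 \<Longrightarrow> norm (D (of_real s)) \<le> C * exp (r / 2 * s)"
    using slit_function_positive_axis_bound[OF slit f(2) half_gt_zero[OF r]] by blast
  define d where "d s = indicator {0<..} s *\<^sub>R D (of_real s)" for s :: real
  have [measurable]: "d \<in> borel_measurable borel"
    unfolding d_def[abs_def] by (rule slit_function_positive_axis_measurable[OF slit f(2)])
  define \<phi> where "\<phi> s x = d s * of_real (indicator {r..} x * (s * exp (- s * x)))" for s x :: real
  have meas: "(\<lambda>(s, x). \<phi> s x) \<in> borel_measurable (lborel \<Otimes>\<^sub>M lborel)"
    unfolding \<phi>_def by measurable
  have ker: "integrable lborel (\<lambda>x. indicator {r..} x * (s * exp (- s * x)))"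
    "(LBINT x. indicator {r..} x * (s * exp (- s * x))) = exp (- r * s)" if "s > 0" for s
  proof -
    have i: "set_integrable lborel {r..} (\<lambda>x. s * exp (- s * x))"
      using set_integrable_exp_minus[OF that] by (rule set_integrable_mult_right)
    then show "integrable lborel (\<lambda>x. indicator {r..} x * (s * exp (- s * x)))"
      by (simp add: set_integrable_def)
    have "(LBINT x:{r..}. s * exp (- s * x)) = exp (- r * s)"
      using that by (simp only: set_integral_mult_right set_integral_exp_minus[OF that]) (simp add: mult.commute)
    then show "(LBINT x. indicator {r..} x * (s * exp (- s * x))) = exp (- r * s)"
      by (simp only: set_lebesgue_integral_def real_scaleR_def)
  qed
  have inner: "integrable lborel (\<phi> s)" "(LBINT x. \<phi> s x) = d s * of_real (exp (- r * s))"
    "(LBINT x. norm (\<phi> s x)) = norm (d s) * exp (- r * s)" for s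
  proof -
    have "integrable lborel (\<phi> s) \<and> (LBINT x. \<phi> s x) = d s * of_real (exp (- r * s)) \<and>
        (LBINT x. norm (\<phi> s x)) = norm (d s) * exp (- r * s)"
    proof (cases "s > 0")
      case True
      have n: "norm (\<phi> s x) = norm (d s) * (indicator {r..} x * (s * exp (- s * x)))" for x
        using True by (simp add: \<phi>_def norm_mult del: of_real_mult)
      have "integrable lborel (\<lambda>x. d s * of_real (indicator {r..} x * (s * exp (- s * x))))"
        by (intro integrable_mult_right integrable_of_real ker True)
      moreover have "(LBINT x. d s * of_real (indicator {r..} x * (s * exp (- s * x)))) = d s * of_real (exp (- r * s))"
        by (simp only: integral_mult_right_zero integral_complex_of_real ker(2)[OF True])
      moreover have "(LBINT x. norm (\<phi> s x)) = norm (d s) * exp (- r * s)"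
        unfolding n by (simp only: integral_mult_right_zero ker(2)[OF True])
      ultimately show ?thesis unfolding \<phi>_def by blast
    qed (simp add: \<phi>_def[abs_def] d_def)
    then show "integrable lborel (\<phi> s)" "(LBINT x. \<phi> s x) = d s * of_real (exp (- r * s))"
      "(LBINT x. norm (\<phi> s x)) = norm (d s) * exp (- r * s)" by auto
  qed
  have outer: "integrable lborel (\<lambda>s. norm (d s) * exp (- r * s))"
  proof (rule Bochner_Integration.integrable_bound)
    have "set_integrable lborel {0..} (\<lambda>s. C * exp (- (r / 2) * s))"
      using r by (intro set_integrable_mult_right set_integrable_exp_minus) auto
    then show "integrable lborel (\<lambda>s. indicator {0..} s *\<^sub>R (C * exp (- (r / 2) * s)))"
      by (simp add: set_integrable_def)
    show "AE s in lborel. norm (norm (d s) * exp (- r * s)) \<le> norm (indicator {0..} s *\<^sub>R (C * exp (- (r / 2) * s)))"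
    proof (rule AE_I2)
      fix s :: real
      show "norm (norm (d s) * exp (- r * s)) \<le> norm (indicator {0..} s *\<^sub>R (C * exp (- (r / 2) * s)))"
      proof (cases "s > 0")
        case True
        have "norm (d s) * exp (- r * s) \<le> C * exp (r / 2 * s) * exp (- r * s)"
          using C(2)[of s] True by (intro mult_right_mono) (auto simp: d_def)
        also have "\<dots> = C * exp (- (r / 2) * s)" by (simp add: exp_add[symmetric])
        finally show ?thesis using True C(1) by simp
      qed (simp add: d_def)
    qed
  qed measurable
  have pair: "integrable (lborel \<Otimes>\<^sub>M lborel) (\<lambda>(s, x). \<phi> s x)"
    by (rule lborel_pair.Fubini_integrable[OF meas]) (use outer inner in auto)
  have slice: "(LBINT s. \<phi> s x) = indicator {r..} x *\<^sub>R ((laplace_L f (of_real x) - f 0) / of_real x)" for x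
  proof (cases "x \<ge> r")
    case True
    then have "(laplace_L f (of_real x) - f 0) / of_real x =
        (LBINT s:{0<..}. of_real (exp (- x * s)) * (of_real s * D (of_real s)))"
      using r by (intro laplace_remainder[OF f _ D]) auto
    also have "\<dots> = (LBINT s. \<phi> s x)"
      unfolding set_lebesgue_integral_def using True
      by (intro Bochner_Integration.integral_cong refl) (auto simp: \<phi>_def d_def indicator_def mult_ac)
    finally show ?thesis using True by simp
  qed (simp add: \<phi>_def)
  show "set_integrable lborel {r..} (\<lambda>x. (laplace_L f (of_real x) - f 0) / of_real x)"
    using lborel_pair.integrable_snd[OF pair] unfolding slice set_integrable_def .
  have "(LBINT x:{r..}. (laplace_L f (of_real x) - f 0) / of_real x) = (LBINT x. LBINT s. \<phi> s x)"
    unfolding set_lebesgue_integral_def slice ..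
  also have "\<dots> = (LBINT s. LBINT x. \<phi> s x)"
    by (rule lborel_pair.Fubini_integral[OF pair])
  also have "\<dots> = (LBINT s:{0<..}. of_real (exp (- r * s)) * D (of_real s))"
    unfolding inner set_lebesgue_integral_def d_def by (simp add: mult.commute)
  finally show "(LBINT x:{r..}. (laplace_L f (of_real x) - f 0) / of_real x) =
      (LBINT s:{0<..}. of_real (exp (- r * s)) * D (of_real s))" .
qed

text \<open>
With \<open>f s = f 0 + s * D s\<close> the integral splits into \<open>f 0\<close> times the exponential integral, which
diverges like \<open>- ln z\<close>, and a part that converges because \<open>s / (z + s) \<le> 1\<close>. The divergence is
compensated by \<open>f (- z) * ln z\<close>; replacing \<open>f (- z)\<close> by \<open>exp (- r * z) * f 0\<close> there costs a term of
order \<open>z * ln z\<close>.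
\<close>

lemma stieltjes_slit_end_tendsto:
  assumes f: "slit_function a f" "a > 0" and r: "r > 0"
  shows "((\<lambda>z. of_real (exp (- r * z)) * (LBINT s:{0<..}. of_real (exp (- r * s)) * f (of_real s) / of_real (z + s))
      + f (- of_real z) * of_real (ln z)) \<longlongrightarrow>
    (LBINT x:{r..}. (laplace_L f (of_real x) - f 0) / of_real x) - f 0 * (euler_mascheroni + of_real (ln r))) (at_right 0)"
proof -
  obtain D where slit: "slit_function a D" and D: "\<And>s. s * D s = f s - f 0"
    using slit_function_difference_quotient_at_zero[OF f] by blast
  obtain C where C: "C \<ge> 0" "\<And>s::real. s \<ge> 0 \<Longrightarrow> norm (D (of_real s)) \<le> C * exp (r / 2 * s)"
    using slit_function_positive_axis_bound[OF slit f(2) half_gt_zero[OF r]] by blast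
  have dm: "(\<lambda>s. indicator {0<..} s *\<^sub>R D (of_real s)) \<in> borel_measurable borel"
    by (rule slit_function_positive_axis_measurable[OF slit f(2)])
  define R where "R z s = of_real (exp (- r * s)) * (of_real s * D (of_real s)) / of_real (z + s)" for z s :: real
  define I where "I z = (LBINT s:{0<..}. exp (- r * s) / (z + s))" for z :: real
  have pos: "\<forall>\<^sub>F z in at_right (0::real). z > 0" by (rule eventually_at_right_less)
  have Rb: "set_borel_measurable lborel {0<..} (R z) \<and> (\<forall>s\<in>{0<..}. norm (R z s) \<le> C * exp (- (r / 2) * s))"
    if z: "z > 0" for z
  proof
    have "(\<lambda>s. of_real (exp (- r * s)) * (of_real s * (indicator {0<..} s *\<^sub>R D (of_real s))) / of_real (z + s))
        \<in> borel_measurable borel"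
      using dm by measurable
    then show "set_borel_measurable lborel {0<..} (R z)"
      unfolding set_borel_measurable_def R_def by (simp add: scaleR_conv_of_real mult_ac)
    show "\<forall>s\<in>{0<..}. norm (R z s) \<le> C * exp (- (r / 2) * s)"
    proof
      fix s :: real assume "s \<in> {0<..}"
      then have s: "s > 0" by simp
      have "norm (R z s) = exp (- r * s) * norm (D (of_real s)) * (s / (z + s))"
        unfolding R_def using s z by (simp add: norm_mult norm_divide del: of_real_add)
      also have "\<dots> \<le> exp (- r * s) * (C * exp (r / 2 * s)) * 1"
        using s z C by (intro mult_mono) auto
      also have "\<dots> = C * (exp (- r * s) * exp (r / 2 * s))" by simp
      also have "exp (- r * s) * exp (r / 2 * s) = exp (- (r / 2) * s)" by (simp add: exp_add[symmetric])
      finally show "norm (R z s) \<le> C * exp (- (r / 2) * s)" .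
    qed
  qed
  have G: "set_integrable lborel {0<..} (\<lambda>s. C * exp (- (r / 2) * s))"
    using r by (intro set_integrable_mult_right set_integrable_subset[OF set_integrable_exp_minus[of "r / 2" 0]]) auto
  have "((\<lambda>z. LBINT s:{0<..}. R z s) \<longlongrightarrow> (LBINT s:{0<..}. R 0 s)) (at_right 0)"
  proof (rule set_dominated_convergence_within(2)[OF _ _ _ G])
    show "\<forall>\<^sub>F z in at_right 0. set_borel_measurable lborel {0<..} (R z) \<and>
        (\<forall>s\<in>{0<..}. norm (R z s) \<le> C * exp (- (r / 2) * s))"
      using pos by (rule eventually_mono) (rule Rb)
    show "((\<lambda>z. R z s) \<longlongrightarrow> R 0 s) (at_right 0)" if "s \<in> {0<..}" for s
      unfolding R_def using that by (intro tendsto_intros) auto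
  qed auto
  moreover have "(LBINT s:{0<..}. R 0 s) = (LBINT x:{r..}. (laplace_L f (of_real x) - f 0) / of_real x)"
    unfolding laplace_tail_integral(2)[OF f r slit D]
    by (intro set_lebesgue_integral_cong) (auto simp: R_def)
  ultimately have Rlim: "((\<lambda>z. LBINT s:{0<..}. R z s) \<longlongrightarrow>
      (LBINT x:{r..}. (laplace_L f (of_real x) - f 0) / of_real x)) (at_right 0)" by simp
  have Ilim: "((\<lambda>z. complex_of_real (I z + ln z)) \<longlongrightarrow> of_real (- euler_mascheroni - ln r)) (at_right 0)"
    unfolding I_def by (intro tendsto_of_real exp_stieltjes_tendsto r)
  have elim: "((\<lambda>z. complex_of_real (exp (- r * z))) \<longlongrightarrow> of_real (exp (- r * 0))) (at_right 0)"
    by (intro tendsto_intros)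
  \<comment> \<open>The bracket vanishes at \<open>z = 0\<close>, so its quotient by \<open>z\<close> has a limit.\<close>
  have corr: "((\<lambda>z. (f (- of_real z) - of_real (exp (- r * z)) * f 0) * of_real (ln z)) \<longlongrightarrow> 0) (at_right 0)"
  proof -
    have to0: "filterlim complex_of_real (at 0) (at_right 0)"
      unfolding filterlim_at
      using pos by (auto intro!: tendsto_eq_intros elim: eventually_mono)
    have "0 \<in> cut_plane a" "f holomorphic_on cut_plane a"
      using f by (auto simp: cut_plane_def slit_function_def)
    then have "(f has_field_derivative deriv f 0) (at (- 0))"
      using holomorphic_derivI[OF _ open_cut_plane] by simp
    then have "((\<lambda>w. f (- w)) has_field_derivative deriv f 0 * - 1) (at 0)"
      by (rule DERIV_chain2) (auto intro!: derivative_eq_intros)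
    then have "((\<lambda>w. f (- w) - exp (- of_real r * w) * f 0) has_field_derivative
        deriv f 0 * - 1 - (exp (- of_real r * 0) * - of_real r) * f 0) (at 0)"
      by (rule DERIV_diff) (auto intro!: derivative_eq_intros)
    then have "((\<lambda>w. (f (- w) - exp (- of_real r * w) * f 0) / w) \<longlongrightarrow>
        deriv f 0 * - 1 - (exp (- of_real r * 0) * - of_real r) * f 0) (at 0)"
      by (simp add: has_field_derivative_iff)
    then have "((\<lambda>w. (f (- w) - exp (- of_real r * w) * f 0) / w * (w * Ln w)) \<longlongrightarrow>
        (deriv f 0 * - 1 - (exp (- of_real r * 0) * - of_real r) * f 0) * 0) (at 0)"
      by (intro tendsto_mult tendsto_times_Ln_zero)
    from filterlim_compose[OF this to0]
    have "((\<lambda>z. (f (- of_real z) - exp (- of_real r * of_real z) * f 0) / of_real z * (of_real z * Ln (of_real z))) \<longlongrightarrow> 0) (at_right 0)"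
      by simp
    then show ?thesis
    proof (rule Lim_transform_eventually)
      show "\<forall>\<^sub>F z in at_right 0. (f (- of_real z) - exp (- of_real r * of_real z) * f 0) / of_real z * (of_real z * Ln (of_real z)) =
          (f (- of_real z) - of_real (exp (- r * z)) * f 0) * of_real (ln z)"
        using pos by (rule eventually_mono) (simp add: Ln_of_real exp_of_real[symmetric])
    qed
  qed
  have "((\<lambda>z. of_real (exp (- r * z)) * (f 0 * of_real (I z + ln z) + (LBINT s:{0<..}. R z s))
      + (f (- of_real z) - of_real (exp (- r * z)) * f 0) * of_real (ln z)) \<longlongrightarrow>
      of_real (exp (- r * 0)) * (f 0 * of_real (- euler_mascheroni - ln r)
        + (LBINT x:{r..}. (laplace_L f (of_real x) - f 0) / of_real x)) + 0) (at_right 0)"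
    by (intro tendsto_intros elim Ilim Rlim corr)
  then have "((\<lambda>z. of_real (exp (- r * z)) * (f 0 * of_real (I z + ln z) + (LBINT s:{0<..}. R z s))
      + (f (- of_real z) - of_real (exp (- r * z)) * f 0) * of_real (ln z)) \<longlongrightarrow>
      (LBINT x:{r..}. (laplace_L f (of_real x) - f 0) / of_real x) - f 0 * (euler_mascheroni + of_real (ln r))) (at_right 0)"
    by (rule tendsto_eq_rhs) (simp add: algebra_simps)
  then show ?thesis
  proof (rule Lim_transform_eventually)
    show "\<forall>\<^sub>F z in at_right 0. of_real (exp (- r * z)) * (f 0 * of_real (I z + ln z) + (LBINT s:{0<..}. R z s))
      + (f (- of_real z) - of_real (exp (- r * z)) * f 0) * of_real (ln z) =
      of_real (exp (- r * z)) * (LBINT s:{0<..}. of_real (exp (- r * s)) * f (of_real s) / of_real (z + s))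
      + f (- of_real z) * of_real (ln z)"
      using pos
    proof eventually_elim
      case (elim z)
      have i1: "set_integrable lborel {0<..} (R z)"
        using G by (rule set_integrable_bound) (use Rb[OF elim] C in \<open>auto intro!: AE_I2 simp: abs_mult\<close>)
      have i2: "set_integrable lborel {0<..} (\<lambda>s. f 0 * of_real (exp (- r * s) / (z + s)))"
      proof (rule set_integrable_mult_right)
        show "set_integrable lborel {0<..} (\<lambda>s. complex_of_real (exp (- r * s) / (z + s)))"
          using integrable_of_real[OF exp_stieltjes_integrable[OF r elim, unfolded set_integrable_def real_scaleR_def], where 'a = complex]
          by (simp only: set_integrable_def scaleR_conv_of_real of_real_mult)
      qed
      have "(LBINT s:{0<..}. of_real (exp (- r * s)) * f (of_real s) / of_real (z + s)) =
          (LBINT s:{0<..}. f 0 * of_real (exp (- r * s) / (z + s)) + R z s)"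
      proof (intro set_lebesgue_integral_cong ballI allI impI)
        fix s :: real
        have "f (of_real s) = f 0 + of_real s * D (of_real s)" by (simp add: D)
        then show "of_real (exp (- r * s)) * f (of_real s) / of_real (z + s) =
            f 0 * of_real (exp (- r * s) / (z + s)) + R z s"
          by (simp add: R_def ring_distribs add_divide_distrib)
      qed auto
      also have "\<dots> = f 0 * of_real (I z) + (LBINT s:{0<..}. R z s)"
        by (simp only: set_integral_add(2)[OF i2 i1] set_integral_mult_right set_integral_complex_of_real I_def)
      finally show ?case by (simp add: algebra_simps)
    qed
  qed
qed

section \<open>The constant term and the theorem\<close>

text \<open>
In the logarithmic coordinate the circle is the segment \<open>- pi \<le> Im w \<le> pi\<close>, on which the transform is
continuous. On the principal sheet the value at the initial point, of argument \<open>- pi\<close>, is read off at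
the other end of the segment; a single point does not affect the integral.
\<close>

lemma contour_integral_laplace_circle:
  assumes f: "slit_function a f" "a > 0" and r: "r > 0"
  defines "J \<equiv> \<lambda>c. integral {- pi..pi} (\<lambda>\<phi>. \<i> * exp (c * of_real r * cis \<phi>) * laplace_log f (of_real (ln r) + of_real \<phi> * \<i>))"
  shows "((\<lambda>\<zeta>. exp (c * \<zeta>) * laplace_L f \<zeta> / \<zeta>) has_contour_integral J c) (part_circlepath 0 r (- pi) pi)"
    and "continuous_on UNIV J"
proof -
  have Q: "continuous_on {- pi..pi} (\<lambda>\<phi>. laplace_log f (of_real (ln r) + of_real \<phi> * \<i>))"
    by (rule continuous_on_compose2[OF analytic_imp_holomorphic[OF laplace_log_continuation(1)[OF f],
            THEN holomorphic_on_imp_continuous_on]])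
      (auto intro!: continuous_intros simp: abs_le_iff)
  have joint: "continuous_on (UNIV \<times> cbox (- pi) pi)
      (\<lambda>(c, \<phi>). \<i> * exp (c * of_real r * cis \<phi>) * laplace_log f (of_real (ln r) + of_real \<phi> * \<i>))"
    unfolding case_prod_unfold
    by (intro continuous_intros continuous_on_compose2[OF Q]) auto
  show "continuous_on UNIV J"
    unfolding J_def using integral_continuous_on_param[OF joint] by simp
  have "continuous_on {- pi..pi} (\<lambda>\<phi>. \<i> * exp (c * of_real r * cis \<phi>) * laplace_log f (of_real (ln r) + of_real \<phi> * \<i>))"
    by (intro continuous_intros Q)
  then have h: "((\<lambda>\<phi>. \<i> * exp (c * of_real r * cis \<phi>) * laplace_log f (of_real (ln r) + of_real \<phi> * \<i>))
      has_integral J c) {- pi..pi}"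
    unfolding J_def by (intro integrable_integral integrable_continuous_real)
  have "((\<lambda>\<phi>. exp (c * (0 + of_real r * cis \<phi>)) * laplace_L f (0 + of_real r * cis \<phi>) / (0 + of_real r * cis \<phi>) * of_real r * \<i> * cis \<phi>)
      has_integral J c) {- pi..pi}"
  proof (rule has_integral_spike[OF _ _ h])
    show "exp (c * (0 + of_real r * cis \<phi>)) * laplace_L f (0 + of_real r * cis \<phi>) / (0 + of_real r * cis \<phi>) * of_real r * \<i> * cis \<phi> =
        \<i> * exp (c * of_real r * cis \<phi>) * laplace_log f (of_real (ln r) + of_real \<phi> * \<i>)"
      if "\<phi> \<in> {- pi..pi} - {- pi}" for \<phi>
    proof -
      have "of_real r * cis \<phi> = exp (of_real (ln r) + of_real \<phi> * \<i>)"
        using r by (simp add: exp_add cis_conv_exp exp_of_real mult.commute)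
      then have "Ln (of_real r * cis \<phi>) = of_real (ln r) + of_real \<phi> * \<i>"
        using that by simp
      then show ?thesis using r by (simp add: laplace_L_def mult_ac)
    qed
  qed simp
  then show "((\<lambda>\<zeta>. exp (c * \<zeta>) * laplace_L f \<zeta> / \<zeta>) has_contour_integral J c) (part_circlepath 0 r (- pi) pi)"
    by (subst has_contour_integral_part_circlepath_iff) auto
qed

text \<open>
Divide the inversion formula by \<open>2 * pi * \<i>\<close>, add the logarithmic term and let \<open>z\<close> decrease to \<open>0\<close>.
\<close>

lemma expansion_constant_term:
  assumes F: "F \<in> H_space a T" and a: "a > 0" and r: "r > 0"
    and h: "h holomorphic_on ball 0 a"
    and hF: "\<And>z. norm z < a \<Longrightarrow> z \<notin> \<real>\<^sub>\<le>\<^sub>0 \<Longrightarrow>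
       h z = F (z - of_real a) + T / (2 * of_real pi * \<i>) * F (- z) * Ln z"
  shows "h 0 = 1 / (2 * of_real pi * \<i>) *
               contour_integral (part_circlepath 0 r (- pi) pi)
                 (\<lambda>\<zeta>. exp (- of_real a * \<zeta>) * laplace_L F \<zeta> / \<zeta>)
             + T / (2 * of_real pi * \<i>) *
               (LBINT x:{r..}. (laplace_L F (of_real x) - F 0) / of_real x)
             - T * F 0 / (2 * of_real pi * \<i>) * (euler_mascheroni + of_real (ln r))"
proof -
  have Fs: "slit_function a F" by (rule H_space_slit_function[OF F a])
  define J where "J c = integral {- pi..pi} (\<lambda>\<phi>. \<i> * exp (c * of_real r * cis \<phi>) * laplace_log F (of_real (ln r) + of_real \<phi> * \<i>))" for c
  define Y where "Y z = (LBINT s:{0<..}. of_real (exp (- r * s)) * F (of_real s) / of_real (z + s))" for z :: real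
  define c where "c = 2 * of_real pi * \<i>"
  have c: "c \<noteq> 0" by (simp add: c_def)
  let ?I = "LBINT x:{r..}. (laplace_L F (of_real x) - F 0) / of_real x"
  have Jc: "continuous_on UNIV J"
    unfolding J_def[abs_def] by (rule contour_integral_laplace_circle(2)[OF Fs a r])
  have Jint: "contour_integral (part_circlepath 0 r (- pi) pi)
                 (\<lambda>\<zeta>. exp (- of_real a * \<zeta>) * laplace_L F \<zeta> / \<zeta>) = J (- of_real a)"
    unfolding J_def by (rule contour_integral_unique[OF contour_integral_laplace_circle(1)[OF Fs a r]])
  have inv: "J (of_real (z - a)) = c * F (of_real (z - a)) - T * of_real (exp (- r * z)) * Y z" if "z > 0" for z
    unfolding J_def c_def Y_def by (rule integral_unique[OF H_space_inversion[OF F a that r]])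
  have pos: "\<forall>\<^sub>F z in at_right (0::real). z \<in> {0<..<a}"
    by (rule eventually_at_right_real[OF a])
  have Jlim: "((\<lambda>z. J (of_real (z - a))) \<longlongrightarrow> J (of_real (0 - a))) (at_right 0)"
    using Jc by (intro isCont_tendsto_compose[of _ J] tendsto_intros)
      (auto simp: continuous_on_eq_continuous_at)
  have "((\<lambda>z. J (of_real (z - a)) / c + T / c * (of_real (exp (- r * z)) * Y z + F (- of_real z) * of_real (ln z))) \<longlongrightarrow>
      J (of_real (0 - a)) / c + T / c * (?I - F 0 * (euler_mascheroni + of_real (ln r)))) (at_right 0)"
    unfolding Y_def using c by (intro tendsto_intros Jlim stieltjes_slit_end_tendsto[OF Fs a r])
  moreover have "\<forall>\<^sub>F z in at_right 0. J (of_real (z - a)) / c + T / c * (of_real (exp (- r * z)) * Y z + F (- of_real z) * of_real (ln z)) =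
      h (of_real z)"
    using pos
  proof eventually_elim
    case (elim z)
    then have z: "0 < z" "z < a" by auto
    have "h (of_real z) = F (of_real z - of_real a) + T / c * F (- of_real z) * Ln (of_real z)"
      unfolding c_def using z by (intro hF) auto
    then show ?case unfolding inv[OF z(1)] using c z
      by (simp add: Ln_of_real diff_divide_distrib distrib_left)
  qed
  ultimately have "((\<lambda>z. h (of_real z)) \<longlongrightarrow>
      J (of_real (0 - a)) / c + T / c * (?I - F 0 * (euler_mascheroni + of_real (ln r)))) (at_right 0)"
    by (rule Lim_transform_eventually)
  moreover have "((\<lambda>z. h (of_real z)) \<longlongrightarrow> h (of_real 0)) (at_right 0)"
  proof (rule isCont_tendsto_compose[of _ h])
    show "isCont h (of_real 0)"
      using h a holomorphic_on_imp_continuous_on continuous_on_eq_continuous_at[of "ball 0 a" h] by auto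
  qed (intro tendsto_intros)
  ultimately have "h (of_real 0) = J (of_real (0 - a)) / c + T / c * (?I - F 0 * (euler_mascheroni + of_real (ln r)))"
    by (intro tendsto_unique[OF trivial_limit_at_right_real])
  then show ?thesis unfolding Jint c_def[symmetric] by (simp add: algebra_simps add_divide_distrib)
qed

theorem theorem2:
  fixes a :: real and T :: complex and F :: "complex \<Rightarrow> complex"
  assumes "a > 0" and "F \<in> H_space a T"
  shows "\<exists>A :: nat \<Rightarrow> complex.
    (\<forall>t\<in>cut_disc a.
       summable (\<lambda>k. norm (A k * (t + of_real a) ^ k)) \<and>
       F t = (\<Sum>k. A k * (t + of_real a) ^ k)
             - T / (2 * of_real pi * \<i>) * F (- (t + of_real a)) * Ln (t + of_real a)) \<and>
    (let P = laplace_L F; p\<^sub>0 = F 0 in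
     \<forall>r>0.
       (\<lambda>\<zeta>. exp (- of_real a * \<zeta>) * P \<zeta> / \<zeta>) contour_integrable_on part_circlepath 0 r (- pi) pi \<and>
       set_integrable lborel {r..} (\<lambda>x. (P (of_real x) - p\<^sub>0) / of_real x) \<and>
       A 0 = 1 / (2 * of_real pi * \<i>) *
               contour_integral (part_circlepath 0 r (- pi) pi)
                 (\<lambda>\<zeta>. exp (- of_real a * \<zeta>) * P \<zeta> / \<zeta>)
             + T / (2 * of_real pi * \<i>) *
               (LBINT x:{r..}. (P (of_real x) - p\<^sub>0) / of_real x)
             - T * p\<^sub>0 / (2 * of_real pi * \<i>) * (euler_mascheroni + of_real (ln r)))"
proof -
  obtain h where h: "h holomorphic_on ball 0 a"
    and hF: "\<And>z. norm z < a \<Longrightarrow> z \<notin> \<real>\<^sub>\<le>\<^sub>0 \<Longrightarrow>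
       h z = F (z - of_real a) + T / (2 * of_real pi * \<i>) * F (- z) * Ln z"
    using H_space_expansion_function[OF assms(2,1)] by blast
  have Fs: "slit_function a F" by (rule H_space_slit_function[OF assms(2,1)])
  define A where "A k = (deriv ^^ k) h 0 / fact k" for k
  have sums: "(\<lambda>k. A k * z ^ k) sums h z" if "norm z < a" for z
    using holomorphic_power_series[OF h, of z] that by (simp add: A_def)
  have abs: "summable (\<lambda>k. norm (A k * z ^ k))" if z: "norm z < a" for z
  proof -
    \<comment> \<open>Convergence at a point of larger modulus makes the series absolutely convergent at \<open>z\<close>.\<close>
    obtain x where x: "norm z < x" "x < a" using dense[OF z] by blast
    then have "\<bar>x\<bar> = x" using norm_ge_zero[of z] by linarith
    then have "summable (\<lambda>k. A k * of_real x ^ k)" "norm z < norm (complex_of_real x)"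
      using x sums_summable[OF sums[of "of_real x"]] by (simp_all only: norm_of_real)
    then show ?thesis by (rule powser_insidea)
  qed
  have exp1: "F t = (\<Sum>k. A k * (t + of_real a) ^ k)
             - T / (2 * of_real pi * \<i>) * F (- (t + of_real a)) * Ln (t + of_real a)"
    and exp2: "summable (\<lambda>k. norm (A k * (t + of_real a) ^ k))" if t: "t \<in> cut_disc a" for t
  proof -
    let ?z = "t + of_real a"
    have z: "norm ?z < a" "?z \<noteq> 0" "\<bar>Arg ?z\<bar> < pi"
      using t by (auto simp: cut_disc_def eq_neg_iff_add_eq_0)
    have "?z \<notin> \<real>\<^sub>\<le>\<^sub>0"
    proof
      assume "?z \<in> \<real>\<^sub>\<le>\<^sub>0"
      then have "Im ?z = 0" "Re ?z \<le> 0" by (simp_all only: complex_nonpos_Reals_iff)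
      moreover have "Re ?z \<noteq> 0"
      proof
        assume "Re ?z = 0"
        with \<open>Im ?z = 0\<close> have "?z = 0" by (intro complex_eqI) simp_all
        with z(2) show False by contradiction
      qed
      ultimately have "Arg ?z = pi" unfolding Arg_eq_pi by linarith
      with z(3) show False by simp
    qed
    from hF[OF z(1) this] sums[OF z(1)]
    show "F t = (\<Sum>k. A k * ?z ^ k) - T / (2 * of_real pi * \<i>) * F (- ?z) * Ln ?z"
      by (simp add: sums_iff)
    show "summable (\<lambda>k. norm (A k * ?z ^ k))" by (rule abs[OF z(1)])
  qed
  have circle: "(\<lambda>\<zeta>. exp (- of_real a * \<zeta>) * laplace_L F \<zeta> / \<zeta>) contour_integrable_on part_circlepath 0 r (- pi) pi"
    if "r > 0" for r
    using contour_integral_laplace_circle(1)[OF Fs assms(1) that] unfolding contour_integrable_on_def by blast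
  obtain D where D: "slit_function a D" "\<And>s. s * D s = F s - F 0"
    using slit_function_difference_quotient_at_zero[OF Fs assms(1)] by blast
  have tail: "set_integrable lborel {r..} (\<lambda>x. (laplace_L F (of_real x) - F 0) / of_real x)" if "r > 0" for r
    by (rule laplace_tail_integral(1)[OF Fs assms(1) that D])
  have "A 0 = h 0" by (simp add: A_def)
  note A0 = trans[OF this expansion_constant_term[OF assms(2,1) _ h hF]]
  show ?thesis
    unfolding Let_def by (intro exI[of _ A] conjI ballI allI impI exp1 exp2 circle tail A0)
qed

end
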